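(* For every $n\ge1$ and every $\pi\in\mathrm{PC}(n)$ let $a(\pi)\in\mathbb{C}$ be an arbitrary complex number, and let $c(\pi)$ (for $\pi\in\mathrm{CO}(n)$) and $d(\pi)$ (for $\pi\in\mathcal{P}(n)$) be the associated weights described in the context. Let $$C(x)=\sum_{n=1}^\infty c_nx^n,\quad c_n=\sum_{\pi\in\mathrm{CO}(n)}c(\pi),\qquad D(x)=1+\sum_{n=1}^\infty d_nx^n,\quad d_n=\sum_{\pi\in\mathcal{P}(n)}d(\pi).$$ Then, as formal power series, $$D(x)=1+C(xD(x)).$$ Moreover, letting $F(x)=xD(x)$ and letting $F^{\langle-1\rangle}$ denote the inverse of $F$ with respect to composition, one has $$F^{\langle-1\rangle}(w)=\frac{w}{1+C(w)}.$$
   Context: $[n]=\{1,\ldots,n\}$ and $\mathcal{P}(n)$ is the set of all set partitions of $[n]$. $\mathrm{NC}(n)\subseteq\mathcal{P}(n)$ is the set of noncrossing partitions. For $\pi\in\mathcal{P}(n)$, write $i\overset{\pi}{\sim}j$ if $i,j$ lie in the same block of $\pi$. A subset $S\subseteq[n]$ splits $\pi$ if $S$ is a union of some of the blocks of $\pi$. Consider, for $\pi\in\mathcal{P}(n)$, $n\ge1$, the conditions: (a) no proper subinterval $\{p+1,p+2,\ldots,p+q\}$ of $[n]$ (with $0\le p<p+q\le n$ and $q<n$) splits $\pi$; (b) $k\not\overset{\pi}{\sim}k+1$ for all $k\in[n-1]$; (c) $1\not\overset{\pi}{\sim}n$. $\mathrm{PC}(n)$ is the set of $\pi\in\mathcal{P}(n)$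 satisfying (a), (b), (c); $\mathrm{PC}^+(n)$ is the set of those satisfying (a) and (b); $\mathrm{CO}(n)$ (connected partitions) is the set of those satisfying (a). Weights $b$: $0_1$ denotes the unique partition of $[1]$. One has $\mathrm{PC}^+(1)=\{0_1\}$ and, for $n\ge2$, $\mathrm{PC}^+(n)$ is the disjoint union of $\mathrm{PC}(n)$ and $\{\tilde\sigma\mid\sigma\in\mathrm{PC}(n-1)\}$, where $\tilde\sigma$ is obtained from $\sigma$ by adjoining $n$ to the block of $\sigma$ that contains $1$. Put $b(0_1)=1$ and, for $n\ge2$, $b(\pi)=a(\pi)$ if $\pi\in\mathrm{PC}(n)$ and $b(\tilde\sigma)=a(\sigma)$ for $\sigma\in\mathrm{PC}(n-1)$. Weights $c$: for $1\le\ell\le n$, $\sigma\in\mathrm{PC}^+(\ell)$ and integers $k_1,\ldots,k_\ell\ge1$ with $k_1+\cdots+k_\ell=n$, let $I_j=\{k_1+\cdots+k_{j-1}+1,\ldots,k_1+\cdots+k_{j-1}+k_j\}$ and $\Phi_n(\sigma,k_1,\ldots,k_\ell)=\{\bigcup_{j\in S}I_j\mid S\in\sigma\}$. The map $\Phi_n$ is a bijection from the set of all such tuples (over all $1\le\ell\le n$) onto $\mathrm{CO}(n)$. Put $c(\pi)=b(\sigma)$ for $\pi\in\mathrm{CO}(n)$, where $\pi=\Phi_n(\sigma,k_1,\ldots,k_\ell)$. Weights $d$: for $\tau=\{B_1,\ldots,B_{|\tau|}\}\in\mathrm{NC}(n)$ (blocks listed in order of increasing minimal elements) and $\sigma_j\in\mathrm{CO}(|B_j|)$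 for $1\le j\le|\tau|$, let $\Psi_n(\tau,\sigma_1,\ldots,\sigma_{|\tau|})=\bigcup_{j=1}^{|\tau|}\psi_{B_j}(\sigma_j)$, where $\psi_B:\{1,\ldots,|B|\}\to B$ is the order-preserving bijection and $\psi_{B}(\sigma)$ is the partition of $B$ obtained by applying $\psi_B$ to every block of $\sigma$. The map $\Psi_n$ is a bijection from the set of all such tuples $(\tau,\sigma_1,\ldots,\sigma_{|\tau|})$ onto $\mathcal{P}(n)$. Put $d(\pi)=\prod_{j=1}^{|\tau|}c(\sigma_j)$ for $\pi=\Psi_n(\tau,\sigma_1,\ldots,\sigma_{|\tau|})$. *)

theory Defs
  imports
    Complex_Main
    "HOL-Library.Disjoint_Sets"
    "HOL-Computational_Algebra.Formal_Power_Series"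
begin

section \<open>Set partitions of \<open>{1..n}\<close>\<close>

definition set_partitions :: "nat \<Rightarrow> nat set set set" where
  "set_partitions n = {\<pi>. partition_on {1..n} \<pi>}"

definition same_block :: "nat set set \<Rightarrow> nat \<Rightarrow> nat \<Rightarrow> bool" where
  "same_block \<pi> i j \<longleftrightarrow> (\<exists>B\<in>\<pi>. i \<in> B \<and> j \<in> B)"

definition splits :: "nat set \<Rightarrow> nat set set \<Rightarrow> bool" where
  "splits S \<pi> \<longleftrightarrow> (\<exists>T\<subseteq>\<pi>. S = \<Union>T)"

definition NC :: "nat \<Rightarrow> nat set set set" where
  "NC n = {\<pi> \<in> set_partitions n.
     \<not> (\<exists>i j k l. i < j \<and> j < k \<and> k < l \<and>
          same_block \<pi> i k \<and> same_block \<pi> j l \<and> \<not> same_block \<pi> i j)}"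

definition no_interval_splits :: "nat \<Rightarrow> nat set set \<Rightarrow> bool" where
  "no_interval_splits n \<pi> \<longleftrightarrow>
     (\<forall>p q. p < p + q \<and> p + q \<le> n \<and> q < n \<longrightarrow> \<not> splits {p+1..p+q} \<pi>)"

definition no_adjacent :: "nat \<Rightarrow> nat set set \<Rightarrow> bool" where
  "no_adjacent n \<pi> \<longleftrightarrow> (\<forall>k\<in>{1..n-1}. \<not> same_block \<pi> k (k+1))"

definition PC :: "nat \<Rightarrow> nat set set set" where
  "PC n = {\<pi> \<in> set_partitions n.
     no_interval_splits n \<pi> \<and> no_adjacent n \<pi> \<and> \<not> same_block \<pi> 1 n}"

definition PC_plus :: "nat \<Rightarrow> nat set set set" where
  "PC_plus n = {\<pi> \<in> set_partitions n. no_interval_splits n \<pi> \<and> no_adjacent n \<pi>}"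

definition CO :: "nat \<Rightarrow> nat set set set" where
  "CO n = {\<pi> \<in> set_partitions n. no_interval_splits n \<pi>}"

section \<open>Weights\<close>

text \<open>
  A partition of \<open>{1..n}\<close> determines \<open>n\<close>, so the arbitrary family of complex numbers
  indexed by \<open>n \<ge> 1\<close> and \<open>\<pi> \<in> PC n\<close> is a single function \<open>a\<close> on \<open>nat set set\<close>, of which
  only the values on \<open>PC n\<close>, \<open>n \<ge> 1\<close>, are used.  Each weight \<open>weight_b a n\<close>,
  \<open>weight_c a n\<close>, \<open>weight_d a n\<close> is only meaningful for \<open>n \<ge> 1\<close> and on \<open>PC_plus n\<close>,
  \<open>CO n\<close>, \<open>set_partitions n\<close>, respectively.  There the uses of \<^const>\<open>the_inv_into\<close>
  below are inverses of bijections.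
\<close>

definition tilde :: "nat \<Rightarrow> nat set set \<Rightarrow> nat set set" where
  "tilde n \<sigma> = (\<lambda>B. if 1 \<in> B then insert n B else B) ` \<sigma>"

definition weight_b :: "(nat set set \<Rightarrow> complex) \<Rightarrow> nat \<Rightarrow> nat set set \<Rightarrow> complex" where
  "weight_b a n \<pi> =
     (if n = 1 then 1
      else if \<pi> \<in> PC n then a \<pi>
      else a (the_inv_into (PC (n-1)) (tilde n) \<pi>))"

text \<open>
  \<open>interval_block ks j\<close>, for \<open>1 \<le> j \<le> length ks\<close>, is the \<open>j\<close>-th of the consecutive
  intervals of lengths \<open>ks\<close>; the index \<open>j\<close> counts from 1, whereas lists count from 0.
\<close>

definition interval_block :: "nat list \<Rightarrow> nat \<Rightarrow> nat set" where
  "interval_block ks j = {sum_list (take (j-1) ks) + 1 .. sum_list (take (j-1) ks) + ks ! (j-1)}"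

definition Phi_dom :: "nat \<Rightarrow> (nat \<times> nat set set \<times> nat list) set" where
  "Phi_dom n = {(l, \<sigma>, ks). 1 \<le> l \<and> l \<le> n \<and> \<sigma> \<in> PC_plus l \<and>
     length ks = l \<and> (\<forall>k\<in>set ks. 1 \<le> k) \<and> sum_list ks = n}"

definition Phi :: "nat \<times> nat set set \<times> nat list \<Rightarrow> nat set set" where
  "Phi = (\<lambda>(l, \<sigma>, ks). (\<lambda>S. \<Union>j\<in>S. interval_block ks j) ` \<sigma>)"

definition weight_c :: "(nat set set \<Rightarrow> complex) \<Rightarrow> nat \<Rightarrow> nat set set \<Rightarrow> complex" where
  "weight_c a n \<pi> = (case the_inv_into (Phi_dom n) Phi \<pi> of (l, \<sigma>, ks) \<Rightarrow> weight_b a l \<sigma>)"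

definition block_list :: "nat set set \<Rightarrow> nat set list" where
  "block_list \<tau> = sorted_key_list_of_set Min \<tau>"

text \<open>The order-preserving bijection from \<open>{1..card B}\<close> onto a finite set \<open>B\<close>.\<close>

definition psi :: "nat set \<Rightarrow> nat \<Rightarrow> nat" where
  "psi B i = sorted_list_of_set B ! (i-1)"

definition psi_partition :: "nat set \<Rightarrow> nat set set \<Rightarrow> nat set set" where
  "psi_partition B \<sigma> = (\<lambda>S. psi B ` S) ` \<sigma>"

definition Psi_dom :: "nat \<Rightarrow> (nat set set \<times> nat set set list) set" where
  "Psi_dom n = {(\<tau>, \<sigma>s). \<tau> \<in> NC n \<and> length \<sigma>s = card \<tau> \<and>
     (\<forall>j<card \<tau>. \<sigma>s ! j \<in> CO (card (block_list \<tau> ! j)))}"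

definition Psi :: "nat set set \<times> nat set set list \<Rightarrow> nat set set" where
  "Psi = (\<lambda>(\<tau>, \<sigma>s). \<Union>j<card \<tau>. psi_partition (block_list \<tau> ! j) (\<sigma>s ! j))"

definition weight_d :: "(nat set set \<Rightarrow> complex) \<Rightarrow> nat \<Rightarrow> nat set set \<Rightarrow> complex" where
  "weight_d a n \<pi> = (case the_inv_into (Psi_dom n) Psi \<pi> of (\<tau>, \<sigma>s) \<Rightarrow>
     \<Prod>j<card \<tau>. weight_c a (card (block_list \<tau> ! j)) (\<sigma>s ! j))"

section \<open>Generating series\<close>

definition C_series :: "(nat set set \<Rightarrow> complex) \<Rightarrow> complex fps" where
  "C_series a = Abs_fps (\<lambda>n. if n = 0 then 0 else \<Sum>\<pi>\<in>CO n. weight_c a n \<pi>)"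

definition D_series :: "(nat set set \<Rightarrow> complex) \<Rightarrow> complex fps" where
  "D_series a = Abs_fps (\<lambda>n. if n = 0 then 1 else \<Sum>\<pi>\<in>set_partitions n. weight_d a n \<pi>)"

end

theory Submission
  imports Defs
begin

text \<open>
  Every partition \<open>\<pi>\<close> has a unique coarser noncrossing partition \<open>\<tau>\<close> on whose blocks \<open>\<pi>\<close> is
  connected: for existence, take \<open>\<tau>\<close> with as many blocks as possible; uniqueness holds because a
  noncrossing partition with several blocks has a block that is a proper interval.  Hence
  \<open>d\<^sub>n\<close> is the sum over noncrossing partitions of the products of the \<open>c\<close>'s of the block sizes, and
  the weights \<open>c\<close> play no further role.

  Put \<open>c\<^sub>0 = 1\<close> and let \<open>H\<^sub>t\<close> be the variant of \<open>D\<close> in which the block of the first element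
  counts as if it had \<open>t\<close> additional elements.  Cutting a noncrossing partition at the second element of
  that block gives \<open>H\<^sub>t = c\<^sub>t + x D H\<^sub>t\<^sub>+\<^sub>1\<close>, and iterating this from \<open>H\<^sub>0 = D\<close>
  yields \<open>D = \<Sum>\<^sub>t c\<^sub>t (x D)\<^sup>t\<close>.
\<close>

section \<open>The noncrossing closure\<close>

text \<open>No ground set is fixed, so the notion passes to subfamilies and makes sense for
  \<open>insert V \<rho>\<close> even when \<open>V\<close> is empty.\<close>

definition noncrossing :: "nat set set \<Rightarrow> bool" where
  "noncrossing \<pi> \<longleftrightarrow> (\<forall>B\<in>\<pi>. \<forall>C\<in>\<pi>. \<forall>i j k l.
     i < j \<and> j < k \<and> k < l \<and> i \<in> B \<and> k \<in> B \<and> j \<in> C \<and> l \<in> C \<longrightarrow> B = C)"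

definition NC_on :: "nat set \<Rightarrow> nat set set set" where
  "NC_on A = {\<pi>. partition_on A \<pi> \<and> noncrossing \<pi>}"

text \<open>For finite \<open>B\<close>, the nonempty sets \<open>B \<inter> {p..q}\<close> are the
  runs of consecutive elements of \<open>B\<close>, so this is the condition defining
  \<open>CO\<close> carried over to \<open>B\<close>.\<close>

definition connected_on :: "nat set \<Rightarrow> nat set set \<Rightarrow> bool" where
  "connected_on B \<rho> \<longleftrightarrow> partition_on B \<rho> \<and>
     (\<forall>p q. B \<inter> {p..q} \<noteq> {} \<longrightarrow> B \<inter> {p..q} \<noteq> B \<longrightarrow> \<not> splits (B \<inter> {p..q}) \<rho>)"

lemma noncrossingD:
  assumes "noncrossing \<pi>" "B \<in> \<pi>" "C \<in> \<pi>" "i < j" "j < k" "k < l"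
    "i \<in> B" "k \<in> B" "j \<in> C" "l \<in> C"
  shows "B = C"
  using assms unfolding noncrossing_def by blast

lemma partition_on_unique_block:
  assumes "partition_on A \<pi>" "B \<in> \<pi>" "C \<in> \<pi>" "x \<in> B" "x \<in> C"
  shows "B = C"
  using assms by (auto simp: partition_on_def disjoint_def)

lemma partition_on_finite_block:
  assumes "finite A" "partition_on A \<pi>" "B \<in> \<pi>"
  shows "finite B"
  using assms by (metis Union_upper finite_subset partition_onD1)

text \<open>In a partition an element determines its block, so for blocks \<open>B\<close> and
  \<open>C\<close> with \<open>i \<in> B\<close> and \<open>j \<in> C\<close> the relation
  \<open>same_block \<pi> i j\<close> amounts to \<open>B = C\<close>.\<close>

lemma NC_eq_NC_on: "NC n = NC_on {1..n}"
proof -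
  have *: "(\<exists>i j k l. i < j \<and> j < k \<and> k < l \<and> same_block \<pi> i k \<and> same_block \<pi> j l \<and> \<not> same_block \<pi> i j)
        \<longleftrightarrow> \<not> noncrossing \<pi>" (is "?cr \<longleftrightarrow> _") if p: "partition_on {1..n} \<pi>" for \<pi>
  proof
    assume ?cr
    then obtain i j k l where lt: "i < j" "j < k" "k < l" and same: "same_block \<pi> i k" "same_block \<pi> j l"
      and n: "\<not> same_block \<pi> i j"
      by blast
    obtain B C where BC: "B \<in> \<pi>" "C \<in> \<pi>" and mem: "i \<in> B" "k \<in> B" "j \<in> C" "l \<in> C"
      using same by (auto simp: same_block_def)
    show "\<not> noncrossing \<pi>"
    proof
      assume "noncrossing \<pi>"
      then have "B = C" using noncrossingD[OF _ BC lt mem] by simp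
      then show False using n BC mem by (auto simp: same_block_def)
    qed
  next
    assume nnc: "\<not> noncrossing \<pi>"
    show ?cr
    proof (rule ccontr)
      assume n: "\<not> ?cr"
      have "noncrossing \<pi>"
        unfolding noncrossing_def
      proof (intro ballI allI impI, elim conjE)
        fix B C i j k l
        assume BC: "B \<in> \<pi>" "C \<in> \<pi>" and lt: "i < j" "j < k" "k < l"
          and mem: "i \<in> B" "k \<in> B" "j \<in> C" "l \<in> C"
        then have "same_block \<pi> i k" "same_block \<pi> j l" by (auto simp: same_block_def)
        then have "same_block \<pi> i j" using n lt by blast
        then obtain E where "E \<in> \<pi>" "i \<in> E" "j \<in> E" by (auto simp: same_block_def)
        then show "B = C"
          using partition_on_unique_block[OF p] BC mem by metis
      qed
      with nnc show False by simp
    qed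
  qed
  show ?thesis
    unfolding NC_def NC_on_def set_partitions_def
    by (intro set_eqI) (simp only: mem_Collect_eq * not_not cong: conj_cong)
qed

text \<open>A block of minimal span is an interval, since a block meeting its span lies strictly inside it.\<close>
lemma noncrossing_interval_block:
  assumes "finite B" "B \<noteq> {}" "partition_on B \<kappa>" "noncrossing \<kappa>"
  obtains E p q where "E \<in> \<kappa>" "E = B \<inter> {p..q}"
proof -
  have ne: "\<kappa> \<noteq> {}" and UN: "\<Union>\<kappa> = B" and emp: "{} \<notin> \<kappa>"
    using assms(2,3) by (auto simp: partition_on_def)
  have fin: "finite E" if "E \<in> \<kappa>" for E
    using partition_on_finite_block[OF assms(1,3) that] .
  define E where "E = arg_min_on (\<lambda>E. Max E - Min E) \<kappa>"
  have finK: "finite \<kappa>" using assms(1,3) finite_elements by blast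
  have E: "E \<in> \<kappa>" unfolding E_def using arg_min_if_finite(1)[OF finK ne] .
  have min: "Max E - Min E \<le> Max G - Min G" if "G \<in> \<kappa>" for G
    unfolding E_def using arg_min_least[OF finK ne that] .
  have Ene: "E \<noteq> {}" using E emp by blast
  have mm: "Min E \<in> E" "Max E \<in> E" using fin[OF E] Ene by auto
  have "x \<in> E" if x: "x \<in> B" "Min E \<le> x" "x \<le> Max E" for x
  proof (rule ccontr)
    assume nx: "x \<notin> E"
    obtain G where G: "G \<in> \<kappa>" "x \<in> G" using x UN by auto
    have GE: "G \<noteq> E" using G nx by auto
    have disj: "y \<notin> E" if "y \<in> G" for y
      using partition_on_unique_block[OF assms(3) E G(1)] that GE by auto
    have strict: "Min E < x" "x < Max E"
      using x nx mm by (metis le_neq_implies_less)+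
    \<comment> \<open>A point of \<open>G\<close> beyond an end of \<open>E\<close>, together with
      \<open>x\<close> inside the span, would cross the pair \<open>Min E\<close>,
      \<open>Max E\<close>.\<close>
    have inside: "Min E < y \<and> y < Max E" if y: "y \<in> G" for y
    proof (rule ccontr)
      assume "\<not> ?thesis"
      moreover have "y \<noteq> Min E" "y \<noteq> Max E" using disj[OF y] mm by auto
      ultimately consider "y < Min E" | "Max E < y" by linarith
      then show False
      proof cases
        case 1
        show ?thesis
          using noncrossingD[OF assms(4) G(1) E 1 strict y G(2) mm] GE by auto
      next
        case 2
        show ?thesis
          using noncrossingD[OF assms(4) E G(1) strict 2 mm G(2) y] GE by auto
      qed
    qed
    have "G \<noteq> {}" using G by auto
    then have "Min E < Min G" "Max G < Max E" using inside fin[OF G(1)] by auto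
    moreover have "Min G \<le> Max G" using G fin[OF G(1)] \<open>G \<noteq> {}\<close> by auto
    ultimately show False using min[OF G(1)] by linarith
  qed
  then have "B \<inter> {Min E..Max E} \<subseteq> E" by auto
  moreover have "E \<subseteq> B \<inter> {Min E..Max E}"
    using UN E fin[OF E] by (intro subsetI IntI) auto
  ultimately have "E = B \<inter> {Min E..Max E}" by (rule equalityI[rotated])
  with E show thesis by (rule that)
qed

section \<open>Uniqueness of the noncrossing closure\<close>

text \<open>The traces of \<open>\<tau>'\<close> on a block \<open>B\<close> of
  \<open>\<tau>\<close> form a noncrossing partition of \<open>B\<close>, so one of these traces,
  \<open>E\<close>, is cut out of \<open>B\<close> by an interval. Since \<open>E\<close> is a union
  of blocks of \<open>\<pi>\<close>, connectedness of \<open>\<pi>\<close> on \<open>B\<close>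
  forces \<open>E = B\<close>, and \<open>B\<close> lies in a single block of
  \<open>\<tau>'\<close>.\<close>

lemma noncrossing_closure_refines:
  assumes A: "finite A" and \<pi>: "partition_on A \<pi>"
    and \<tau>: "\<tau> \<in> NC_on A" "\<And>B. B \<in> \<tau> \<Longrightarrow> connected_on B {X \<in> \<pi>. X \<subseteq> B}"
    and \<tau>': "\<tau>' \<in> NC_on A" "\<And>B. B \<in> \<tau>' \<Longrightarrow> connected_on B {X \<in> \<pi>. X \<subseteq> B}"
  shows "refines A \<tau> \<tau>'"
  unfolding refines_def
proof (intro conjI ballI)
  show p: "partition_on A \<tau>" and p': "partition_on A \<tau>'"
    using \<tau>(1) \<tau>'(1) by (auto simp: NC_on_def)
  fix B assume B: "B \<in> \<tau>"
  have BA: "B \<subseteq> A" using p B by (auto simp: partition_on_def)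
  have Bne: "B \<noteq> {}" using p B by (auto simp: partition_on_def)
  define \<kappa> where "\<kappa> = (\<inter>) B ` \<tau>' - {{}}"
  have "partition_on B \<kappa>"
    using partition_on_restrict[OF p', of B] BA by (simp add: \<kappa>_def Int_absorb2)
  moreover have "noncrossing \<kappa>"
    using \<tau>'(1) unfolding noncrossing_def \<kappa>_def NC_on_def by blast
  ultimately obtain E p q where E: "E \<in> \<kappa>" "E = B \<inter> {p..q}"
    using noncrossing_interval_block finite_subset[OF BA A] Bne by metis
  obtain Y where Y: "Y \<in> \<tau>'" "E = B \<inter> Y" "E \<noteq> {}"
    using E(1) by (auto simp: \<kappa>_def)
  have PB: "partition_on B {X \<in> \<pi>. X \<subseteq> B}" and PY: "partition_on Y {X \<in> \<pi>. X \<subseteq> Y}"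
    using \<tau>(2)[OF B] \<tau>'(2)[OF Y(1)] by (auto simp: connected_on_def)
  \<comment> \<open>\<open>B\<close> and \<open>Y\<close> are both unions of blocks of
    \<open>\<pi>\<close>; as these blocks are disjoint, \<open>B \<inter> Y\<close> is such a union
    too.\<close>
  have "E = \<Union>{X \<in> \<pi>. X \<subseteq> B \<and> X \<subseteq> Y}"
  proof
    show "E \<subseteq> \<Union>{X \<in> \<pi>. X \<subseteq> B \<and> X \<subseteq> Y}"
    proof
      fix x assume "x \<in> E"
      then obtain X X' where "X \<in> \<pi>" "X \<subseteq> B" "x \<in> X" "X' \<in> \<pi>" "X' \<subseteq> Y" "x \<in> X'"
        using Y(2) partition_onD1[OF PB] partition_onD1[OF PY] by blast
      then show "x \<in> \<Union>{X \<in> \<pi>. X \<subseteq> B \<and> X \<subseteq> Y}"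
        using partition_on_unique_block[OF \<pi>, of X X'] by auto
    qed
  qed (use Y in auto)
  then have "splits E {X \<in> \<pi>. X \<subseteq> B}"
    unfolding splits_def by (intro exI[of _ "{X \<in> \<pi>. X \<subseteq> B \<and> X \<subseteq> Y}"]) auto
  then have "E = B"
    using \<tau>(2)[OF B] E(2) Y(3) unfolding connected_on_def by blast
  then show "\<exists>Y\<in>\<tau>'. B \<subseteq> Y" using Y by auto
qed

text \<open>The hypotheses are symmetric in \<open>\<tau>\<close> and \<open>\<tau>'\<close>, so
  each refines the other.\<close>

lemma noncrossing_closure_unique:
  assumes "finite A" "partition_on A \<pi>"
    and "\<tau> \<in> NC_on A" "\<And>B. B \<in> \<tau> \<Longrightarrow> connected_on B {X \<in> \<pi>. X \<subseteq> B}"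
    and "\<tau>' \<in> NC_on A" "\<And>B. B \<in> \<tau>' \<Longrightarrow> connected_on B {X \<in> \<pi>. X \<subseteq> B}"
  shows "\<tau> = \<tau>'"
  using noncrossing_closure_refines[OF assms(1,2)] assms(3-) by (intro refines_asym[of A]) blast+

section \<open>Existence of the noncrossing closure\<close>

text \<open>A crossing between members of the new family is a crossing between the old blocks
  containing them, so both come from the same old block. The two pieces of \<open>B\<close> cannot
  cross, since \<open>I\<close> contains every element of \<open>B\<close> lying between two
  elements of \<open>I\<close>.\<close>

lemma noncrossing_split_block:
  assumes p: "partition_on A \<tau>" and nc: "noncrossing \<tau>" and B: "B \<in> \<tau>"
    and I: "I = B \<inter> {p..q}"
  shows "noncrossing (insert I (insert (B - I) (\<tau> - {B})))"
  unfolding noncrossing_def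
proof (intro ballI allI impI, elim conjE)
  fix C D i j k l
  assume C: "C \<in> insert I (insert (B - I) (\<tau> - {B}))" and D: "D \<in> insert I (insert (B - I) (\<tau> - {B}))"
    and lt: "i < j" "j < k" "k < l" and mem: "i \<in> C" "k \<in> C" "j \<in> D" "l \<in> D"
  obtain C' where C': "C' \<in> \<tau>" "C \<subseteq> C'" "C' = B \<longrightarrow> C = I \<or> C = B - I" "C' \<noteq> B \<longrightarrow> C = C'"
    using C B I by auto
  obtain D' where D': "D' \<in> \<tau>" "D \<subseteq> D'" "D' = B \<longrightarrow> D = I \<or> D = B - I" "D' \<noteq> B \<longrightarrow> D = D'"
    using D B I by auto
  have eq: "C' = D'"
    using noncrossingD[OF nc C'(1) D'(1) lt] mem C'(2) D'(2) by blast
  show "C = D"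
  proof (cases "C' = B")
    case True
    then have "C = I \<or> C = B - I" "D = I \<or> D = B - I" using C' D' eq by auto
    then show ?thesis using mem lt unfolding I by auto
  next
    case False
    then show ?thesis using C' D' eq by auto
  qed
qed

text \<open>Take \<open>\<tau>\<close> with as many blocks as possible: if a block of \<open>\<tau>\<close> had a splitting subinterval,
  cutting the block along that subinterval would give a noncrossing partition with more blocks.\<close>
lemma noncrossing_closure_exists:
  assumes A: "finite A" "A \<noteq> {}" and \<pi>: "partition_on A \<pi>"
  obtains \<tau> where "\<tau> \<in> NC_on A" "\<And>B. B \<in> \<tau> \<Longrightarrow> connected_on B {X \<in> \<pi>. X \<subseteq> B}"
proof -
  define S where "S = {\<tau> \<in> NC_on A. refines A \<pi> \<tau>}"
  have "finite S"
    using finite_subset[OF _ finitely_many_partition_on[OF A(1)], of S] by (auto simp: S_def NC_on_def)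
  \<comment> \<open>The one-block partition is a candidate, so a maximal number of blocks is
    attained.\<close>
  moreover have "{A} \<in> S"
    using \<pi> A partition_on_space[of A]
    by (auto simp: S_def NC_on_def refines_def noncrossing_def partition_on_def)
  ultimately have fS: "finite (card ` S)" "card ` S \<noteq> {}" by auto
  then obtain \<tau> where \<tau>: "\<tau> \<in> S" and "card \<tau> = Max (card ` S)" using Max_in by (metis imageE)
  then have max: "card \<tau>' \<le> card \<tau>" if "\<tau>' \<in> S" for \<tau>'
    using that fS by simp
  have p: "partition_on A \<tau>" and nc: "noncrossing \<tau>" and r: "refines A \<pi> \<tau>"
    using \<tau> by (auto simp: S_def NC_on_def)
  have fin: "finite \<tau>" using finite_elements[OF A(1) p] .
  have "connected_on B {X \<in> \<pi>. X \<subseteq> B}" if B: "B \<in> \<tau>" for B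
    unfolding connected_on_def
  proof (intro conjI allI impI notI)
    show PB: "partition_on B {X \<in> \<pi>. X \<subseteq> B}" by (rule refines_obtains_subset[OF r B])
    fix p' q'
    define I where "I = B \<inter> {p'..q'}"
    assume "B \<inter> {p'..q'} \<noteq> {}" "B \<inter> {p'..q'} \<noteq> B" "splits (B \<inter> {p'..q'}) {X \<in> \<pi>. X \<subseteq> B}"
    then have I: "I \<noteq> {}" "I \<noteq> B" "I \<subseteq> B" and sp: "splits I {X \<in> \<pi>. X \<subseteq> B}"
      by (auto simp: I_def)
    obtain T where T: "T \<subseteq> {X \<in> \<pi>. X \<subseteq> B}" "I = \<Union>T" using sp by (auto simp: splits_def)
    define \<tau>' where "\<tau>' = insert I (insert (B - I) (\<tau> - {B}))"
    have other: "C \<inter> B = {}" if "C \<in> \<tau>" "C \<noteq> B" for C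
      using that p B by (auto simp: partition_on_def disjoint_def)
    have p2: "partition_on A \<tau>'"
    proof (rule partition_onI)
      show "\<Union>\<tau>' = A" using partition_onD1[OF p] B I(3) unfolding \<tau>'_def by auto
      show "{} \<notin> \<tau>'" using partition_onD3[OF p] I unfolding \<tau>'_def by auto
      fix C D assume C: "C \<in> \<tau>'" and D: "D \<in> \<tau>'" and ne: "C \<noteq> D"
      have "C = D" if "x \<in> C" "x \<in> D" for x
      proof (cases "x \<in> B")
        case True
        then have "C = I \<or> C = B - I" "D = I \<or> D = B - I"
          using C D other that unfolding \<tau>'_def by blast+
        then show ?thesis using that by blast
      next
        case False
        then have "C \<in> \<tau>" "D \<in> \<tau>" using C D that I unfolding \<tau>'_def by blast+
        then show ?thesis using partition_on_unique_block[OF p] that by blast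
      qed
      with ne show "disjnt C D" by (auto simp: disjnt_def)
    qed
    \<comment> \<open>\<open>I\<close> is a union of blocks of \<open>\<pi>\<close>, so a block of
      \<open>\<pi>\<close> inside \<open>B\<close> lies either in \<open>I\<close> or in
      \<open>B - I\<close>, and the cut does not break it.\<close>
    have r2: "refines A \<pi> \<tau>'"
      unfolding refines_def
    proof (intro conjI ballI p2 \<pi>)
      fix X assume X: "X \<in> \<pi>"
      obtain Y where Y: "Y \<in> \<tau>" "X \<subseteq> Y" using r X by (auto simp: refines_def)
      show "\<exists>Y\<in>\<tau>'. X \<subseteq> Y"
      proof (cases "Y = B")
        case True
        show ?thesis
        proof (cases "X \<in> T")
          case True then show ?thesis using T by (auto simp: \<tau>'_def)
        next
          case False
          have "X \<inter> Z = {}" if "Z \<in> T" for Z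
            using partition_on_unique_block[OF \<pi> X, of Z] that T(1) False by blast
          then have "X \<subseteq> B - I" using T(2) Y True by auto
          then show ?thesis by (auto simp: \<tau>'_def)
        qed
      qed (use Y in \<open>auto simp: \<tau>'_def\<close>)
    qed
    have "noncrossing \<tau>'"
      unfolding \<tau>'_def by (rule noncrossing_split_block[OF p nc B I_def])
    then have "\<tau>' \<in> S" using p2 r2 by (auto simp: S_def NC_on_def)
    \<comment> \<open>Both pieces are nonempty subsets of \<open>B\<close> and differ from each
      other and from the remaining blocks, so replacing \<open>B\<close> by them raises the number
      of blocks by one.\<close>
    moreover have "I \<notin> insert (B - I) (\<tau> - {B})" "B - I \<notin> \<tau> - {B}"
      using other I by blast+
    then have "card \<tau>' = Suc (card \<tau>)"
      unfolding \<tau>'_def using fin B by (simp add: card_gt_0_iff) (metis Suc_pred card_gt_0_iff empty_iff)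
    ultimately show False using max[of \<tau>'] by auto
  qed
  then show thesis using that p nc by (auto simp: NC_on_def)
qed

section \<open>Bijectivity of \<open>Psi\<close>\<close>

lemma psi_bij_betw:
  assumes "finite B"
  shows "bij_betw (psi B) {1..card B} B"
proof -
  have "bij_betw ((!) (sorted_list_of_set B)) {..<card B} B"
    using bij_betw_nth[of "sorted_list_of_set B" "{..<card B}" B] assms by simp
  moreover have "bij_betw (\<lambda>i. i - 1) {1..card B} {..<card B}"
    by (rule bij_betw_byWitness[where f' = Suc]) auto
  ultimately show ?thesis
    using bij_betw_trans unfolding psi_def comp_def by fastforce
qed

lemma psi_less_iff:
  assumes "finite B" "i \<in> {1..card B}" "j \<in> {1..card B}"
  shows "psi B i < psi B j \<longleftrightarrow> i < j"
proof -
  have *: "psi B i < psi B j" if "i \<in> {1..card B}" "j \<in> {1..card B}" "i < j" for i j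
    using sorted_wrt_nth_less[OF strict_sorted_list_of_set, of "i - 1" "j - 1" B] that assms(1)
    by (auto simp: psi_def)
  show ?thesis
    using *[of i j] *[of j i] assms(2,3) by (metis less_asym' linorder_neqE_nat)
qed

lemma psi_le_iff:
  assumes "finite B" "i \<in> {1..card B}" "j \<in> {1..card B}"
  shows "psi B i \<le> psi B j \<longleftrightarrow> i \<le> j"
  using psi_less_iff[OF assms(1) assms(3,2)] by (simp add: linorder_not_less[symmetric])

lemma partition_on_bij_image:
  assumes "bij_betw f A B" "partition_on A \<rho>"
  shows "partition_on B ((`) f ` \<rho>)"
proof -
  \<comment> \<open>The library result removes the empty set from the image; no block is empty, so
    nothing is removed here.\<close>
  have "(`) f ` \<rho> - {{}} = (`) f ` \<rho>" using partition_onD3[OF assms(2)] by auto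
  then show ?thesis
    using partition_on_inj_image[OF assms(2), of f] assms(1) by (simp add: bij_betw_def)
qed

lemma splits_image_iff:
  assumes f: "inj_on f A" and S: "S \<subseteq> A" and \<rho>: "\<Union>\<rho> \<subseteq> A"
  shows "splits (f ` S) ((`) f ` \<rho>) \<longleftrightarrow> splits S \<rho>"
proof
  assume "splits (f ` S) ((`) f ` \<rho>)"
  then obtain T' where "T' \<subseteq> (`) f ` \<rho>" and eq: "f ` S = \<Union>T'" by (auto simp: splits_def)
  then obtain T where T: "T \<subseteq> \<rho>" "T' = (`) f ` T" by (meson subset_imageE)
  then have "f ` S = f ` \<Union>T" using eq by auto
  then have "S = \<Union>T"
    using inj_on_image_eq_iff[OF f S] T \<rho> by (metis Union_mono order_trans)
  with T show "splits S \<rho>" by (auto simp: splits_def)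
next
  assume "splits S \<rho>"
  then obtain T where "T \<subseteq> \<rho>" "S = \<Union>T" by (auto simp: splits_def)
  then show "splits (f ` S) ((`) f ` \<rho>)"
    unfolding splits_def by (intro exI[of _ "(`) f ` T"]) auto
qed

text \<open>As an order isomorphism, \<open>psi B\<close> matches the proper subintervals of
  \<open>{1..card B}\<close> with the proper traces of intervals on \<open>B\<close>, and a
  bijection preserves splitting.\<close>

lemma connected_on_psi_partition_iff:
  assumes B: "finite B" and \<sigma>: "partition_on {1..card B} \<sigma>"
  shows "connected_on B (psi_partition B \<sigma>) \<longleftrightarrow> no_interval_splits (card B) \<sigma>"
proof -
  have bij: "bij_betw (psi B) {1..card B} B" by (rule psi_bij_betw[OF B])
  have inj: "inj_on (psi B) {1..card B}" and im: "psi B ` {1..card B} = B"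
    using bij by (auto simp: bij_betw_def)
  have PB: "partition_on B (psi_partition B \<sigma>)"
    unfolding psi_partition_def by (rule partition_on_bij_image[OF bij \<sigma>])
  have split: "splits (psi B ` S) (psi_partition B \<sigma>) \<longleftrightarrow> splits S \<sigma>" if "S \<subseteq> {1..card B}" for S
    unfolding psi_partition_def
    using partition_onD1[OF \<sigma>] by (intro splits_image_iff[OF inj that]) simp
  have card_psi: "card (psi B ` S) = card S" if "S \<subseteq> {1..card B}" for S
    using card_image inj inj_on_subset that by blast
  show ?thesis
  proof
    assume con: "connected_on B (psi_partition B \<sigma>)"
    show "no_interval_splits (card B) \<sigma>"
      unfolding no_interval_splits_def
    proof (intro allI impI, elim conjE)
      fix p q assume q: "p < p + q" "p + q \<le> card B" "q < card B"
      let ?I = "{p+1..p+q}"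
      have sub: "?I \<subseteq> {1..card B}" using q by auto
      have eq: "psi B ` ?I = B \<inter> {psi B (p+1)..psi B (p+q)}"
      proof
        show "psi B ` ?I \<subseteq> B \<inter> {psi B (p+1)..psi B (p+q)}"
          using q im sub psi_le_iff[OF B] by auto
        show "B \<inter> {psi B (p+1)..psi B (p+q)} \<subseteq> psi B ` ?I"
        proof
          fix x assume x: "x \<in> B \<inter> {psi B (p+1)..psi B (p+q)}"
          then obtain i where i: "i \<in> {1..card B}" "x = psi B i" using im by blast
          then have "i \<in> ?I" using x q psi_le_iff[OF B, of "p+1" i] psi_le_iff[OF B i(1), of "p+q"] by auto
          then show "x \<in> psi B ` ?I" using i by blast
        qed
      qed
      have "psi B ` ?I \<noteq> {}" using q by auto
      moreover have "psi B ` ?I \<noteq> B" using card_psi[OF sub] q by auto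
      ultimately have "\<not> splits (psi B ` ?I) (psi_partition B \<sigma>)"
        using con unfolding connected_on_def eq by blast
      then show "\<not> splits ?I \<sigma>" using split[OF sub] by simp
    qed
  next
    assume nis: "no_interval_splits (card B) \<sigma>"
    show "connected_on B (psi_partition B \<sigma>)"
      unfolding connected_on_def
    proof (intro conjI allI impI PB)
      fix p q assume ne: "B \<inter> {p..q} \<noteq> {}" "B \<inter> {p..q} \<noteq> B"
      \<comment> \<open>The indices of the elements of \<open>B\<close> in \<open>{p..q}\<close>. By
        monotonicity \<open>J\<close> is convex, hence the full interval from its minimum to its
        maximum.\<close>
      define J where "J = {i \<in> {1..card B}. psi B i \<in> {p..q}}"
      have sub: "J \<subseteq> {1..card B}" by (auto simp: J_def)
      have fin: "finite J" using sub finite_subset by blast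
      have "psi B ` {1..card B} \<inter> {p..q} = psi B ` J" by (auto simp: J_def)
      then have eq: "B \<inter> {p..q} = psi B ` J" by (simp only: im)
      have Jne: "J \<noteq> {}" using ne(1) eq by auto
      have mM: "Min J \<in> J" "Max J \<in> J" using fin Jne by auto
      have J: "J = {Min J..Max J}"
      proof
        show "{Min J..Max J} \<subseteq> J"
        proof
          fix i assume i: "i \<in> {Min J..Max J}"
          then have i': "i \<in> {1..card B}" using mM sub by auto
          have "psi B (Min J) \<le> psi B i" "psi B i \<le> psi B (Max J)"
            using i i' mM sub psi_le_iff[OF B] by (auto simp: subset_iff)
          then show "i \<in> J" using mM i' by (auto simp: J_def)
        qed
      qed (use fin in auto)
      \<comment> \<open>Offset and length of \<open>J\<close>, to match the form
        \<open>{p+1..p+q}\<close> in \<open>no_interval_splits\<close>. The subtractions are exact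
        because \<open>1 \<le> Min J \<le> Max J\<close>.\<close>
      define p' where "p' = Min J - 1"
      define q' where "q' = Max J + 1 - Min J"
      have b: "1 \<le> Min J" "Min J \<le> Max J" "Max J \<le> card B" using mM sub fin Jne by auto
      have J': "J = {p'+1..p'+q'}" using J b by (simp add: p'_def q'_def)
      have "q' = card J" using J' by simp
      have "J \<noteq> {1..card B}" using ne(2) eq im by metis
      then have "card J < card B"
        using psubset_card_mono[of "{1..card B}" J] sub by auto
      then have "p' < p' + q'" "p' + q' \<le> card B" "q' < card B"
        using b \<open>q' = card J\<close> by (simp_all add: p'_def q'_def)
      then have "\<not> splits {p'+1..p'+q'} \<sigma>"
        using nis unfolding no_interval_splits_def by blast
      then show "\<not> splits (B \<inter> {p..q}) (psi_partition B \<sigma>)"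
        using split[OF sub] eq J' by simp
    qed
  qed
qed

text \<open>This identifies a component of a tuple in \<open>Psi_dom\<close> with a connected
  partition of the corresponding block. Relabelling back along the inverse of \<open>psi B\<close>
  undoes \<open>psi_partition B\<close>.\<close>

lemma psi_partition_bij_betw:
  assumes B: "finite B"
  shows "bij_betw (psi_partition B) (CO (card B)) {\<rho>. connected_on B \<rho>}"
proof -
  define g where "g = the_inv_into {1..card B} (psi B)"
  have bij: "bij_betw (psi B) {1..card B} B" by (rule psi_bij_betw[OF B])
  have gbij: "bij_betw g B {1..card B}"
    unfolding g_def by (rule bij_betw_the_inv_into[OF bij])
  have gf: "g (psi B i) = i" if "i \<in> {1..card B}" for i
    unfolding g_def using bij that by (intro the_inv_into_f_f) (auto simp: bij_betw_def)
  have fg: "psi B (g x) = x" if "x \<in> B" for x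
    unfolding g_def using bij that by (intro f_the_inv_into_f) (auto simp: bij_betw_def)
  have inv1: "(`) g ` psi_partition B \<sigma> = \<sigma>" if "partition_on {1..card B} \<sigma>" for \<sigma>
  proof -
    have "g ` psi B ` S = S" if S: "S \<in> \<sigma>" for S
    proof -
      have "S \<subseteq> {1..card B}" using partition_onD1[OF \<open>partition_on {1..card B} \<sigma>\<close>] S by auto
      then show ?thesis using gf by (force simp: image_image)
    qed
    then show ?thesis by (simp add: psi_partition_def image_image)
  qed
  have inv2: "psi_partition B ((`) g ` \<rho>) = \<rho>" if "partition_on B \<rho>" for \<rho>
  proof -
    have "psi B ` g ` S = S" if S: "S \<in> \<rho>" for S
    proof -
      have "S \<subseteq> B" using partition_onD1[OF \<open>partition_on B \<rho>\<close>] S by auto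
      then show ?thesis using fg by (force simp: image_image)
    qed
    then show ?thesis by (simp add: psi_partition_def image_image)
  qed
  show ?thesis
  proof (rule bij_betw_byWitness[where f' = "(`) ((`) g)"])
    show "\<forall>\<sigma>\<in>CO (card B). (`) g ` psi_partition B \<sigma> = \<sigma>"
      using inv1 by (auto simp: CO_def set_partitions_def)
    show "\<forall>\<rho>\<in>{\<rho>. connected_on B \<rho>}. psi_partition B ((`) g ` \<rho>) = \<rho>"
      using inv2 by (auto simp: connected_on_def)
    show "psi_partition B ` CO (card B) \<subseteq> {\<rho>. connected_on B \<rho>}"
      using connected_on_psi_partition_iff[OF B] by (auto simp: CO_def set_partitions_def)
    show "(`) ((`) g) ` {\<rho>. connected_on B \<rho>} \<subseteq> CO (card B)"
    proof
      fix \<sigma> assume "\<sigma> \<in> (`) ((`) g) ` {\<rho>. connected_on B \<rho>}"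
      then obtain \<rho> where \<rho>: "connected_on B \<rho>" "\<sigma> = (`) g ` \<rho>" by auto
      then have p: "partition_on B \<rho>" by (auto simp: connected_on_def)
      have s: "partition_on {1..card B} \<sigma>"
        using partition_on_bij_image[OF gbij p] \<rho>(2) by simp
      then show "\<sigma> \<in> CO (card B)"
        using connected_on_psi_partition_iff[OF B s] inv2[OF p] \<rho>
        by (auto simp: CO_def set_partitions_def)
    qed
  qed
qed

section \<open>Enumerating blocks and gluing partitions\<close>

lemma (in linorder) sorted_key_list_of_set_bij_betw:
  assumes "inj_on f A" "finite A"
  shows "bij_betw (\<lambda>j. sorted_key_list_of_set f A ! j) {..<card A} A"
proof -
  interpret folding_insort_key "(\<le>)" "(<)" A f
    using assms(1) by unfold_locales
  have "distinct (sorted_key_list_of_set f A)"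
    using distinct_sorted_key_list_of_set[of A] by (simp add: distinct_if_distinct_map)
  then show ?thesis
    using bij_betw_nth[of "sorted_key_list_of_set f A" "{..<card A}" A] assms(2) by simp
qed

text \<open>Blocks are disjoint and contain their minima, so distinct blocks have distinct minima
  and sorting by \<open>Min\<close> lists each block exactly once.\<close>

lemma block_list_bij_betw:
  assumes "finite A" "partition_on A \<tau>"
  shows "bij_betw (\<lambda>j. block_list \<tau> ! j) {..<card \<tau>} \<tau>"
proof -
  have fin: "finite B" "B \<noteq> {}" if "B \<in> \<tau>" for B
    using partition_on_finite_block[OF assms that] partition_onD3[OF assms(2)] that by auto
  have "inj_on Min \<tau>"
  proof (rule inj_onI)
    fix B C assume BC: "B \<in> \<tau>" "C \<in> \<tau>" "Min B = Min C"
    then have "Min B \<in> B" "Min B \<in> C" using fin Min_in by metis+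
    then show "B = C" using partition_on_unique_block[OF assms(2)] BC by blast
  qed
  then show ?thesis
    unfolding block_list_def using finite_elements[OF assms]
    by (rule sorted_key_list_of_set_bij_betw)
qed

text \<open>A member of \<open>R i\<close> is nonempty and contained in \<open>Bs i\<close>, so it
  meets no other block. Hence the pieces stay disjoint, and each \<open>R j\<close> can be read off
  from the union.\<close>

lemma partition_on_glue:
  assumes \<tau>: "partition_on A \<tau>" and Bs: "bij_betw Bs J \<tau>"
    and R: "\<And>j. j \<in> J \<Longrightarrow> partition_on (Bs j) (R j)"
  shows "partition_on A (\<Union>j\<in>J. R j)"
    and "j \<in> J \<Longrightarrow> {X \<in> (\<Union>j\<in>J. R j). X \<subseteq> Bs j} = R j"
proof -
  have im: "Bs ` J = \<tau>" and inj: "inj_on Bs J" using Bs by (auto simp: bij_betw_def)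
  have sub: "X \<subseteq> Bs j" "X \<noteq> {}" if "j \<in> J" "X \<in> R j" for X j
    using R[OF that(1)] that(2) by (auto simp: partition_on_def)
  have same: "i = j" if X: "i \<in> J" "j \<in> J" "X \<in> R i" "X \<subseteq> Bs j \<or> X \<inter> Bs j \<noteq> {}" for i j X
  proof -
    obtain x where "x \<in> Bs i" "x \<in> Bs j" using X(4) sub[OF X(1,3)] by blast
    then have "Bs i = Bs j" using partition_on_unique_block[OF \<tau>] X(1,2) im by blast
    then show ?thesis using inj X(1,2) by (auto dest: inj_onD)
  qed
  show "{X \<in> (\<Union>j\<in>J. R j). X \<subseteq> Bs j} = R j" if "j \<in> J"
    using same sub that by blast
  show "partition_on A (\<Union>j\<in>J. R j)"
  proof (rule partition_onI)
    have "\<Union>(\<Union>j\<in>J. R j) = (\<Union>j\<in>J. Bs j)"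
      using partition_onD1[OF R] by blast
    then show "\<Union>(\<Union>j\<in>J. R j) = A"
      using partition_onD1[OF \<tau>] im by simp
    show "{} \<notin> (\<Union>j\<in>J. R j)" using sub by blast
    fix X Y assume "X \<in> (\<Union>j\<in>J. R j)" "Y \<in> (\<Union>j\<in>J. R j)" "X \<noteq> Y"
    then obtain i j where ij: "i \<in> J" "j \<in> J" "X \<in> R i" "Y \<in> R j" "X \<noteq> Y" by blast
    show "disjnt X Y"
    proof (cases "i = j")
      case True
      then show ?thesis using R[OF ij(1)] ij by (auto simp: partition_on_def pairwise_def)
    next
      case False
      then have "X \<inter> Bs j = {}" using same[OF ij(1,2,3)] by blast
      then show ?thesis using sub[OF ij(2,4)] by (auto simp: disjnt_def)
    qed
  qed
qed

section \<open>The noncrossing closure of a glued partition\<close>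

text \<open>The last claim says that \<open>\<tau>\<close> is the noncrossing closure of
  \<open>Psi (\<tau>, \<sigma>s)\<close>; the one before it recovers each component of
  \<open>\<sigma>s\<close> up to relabelling. Together they give injectivity of
  \<open>Psi\<close>.\<close>

lemma Psi_dom_components:
  assumes "(\<tau>, \<sigma>s) \<in> Psi_dom n"
  shows "\<tau> \<in> NC_on {1..n}" "length \<sigma>s = card \<tau>"
    and "bij_betw (\<lambda>j. block_list \<tau> ! j) {..<card \<tau>} \<tau>"
    and "\<And>j. j < card \<tau> \<Longrightarrow> finite (block_list \<tau> ! j)"
    and "\<And>j. j < card \<tau> \<Longrightarrow> \<sigma>s ! j \<in> CO (card (block_list \<tau> ! j))"
    and "partition_on {1..n} (Psi (\<tau>, \<sigma>s))"
    and "\<And>j. j < card \<tau> \<Longrightarrow>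
           {X \<in> Psi (\<tau>, \<sigma>s). X \<subseteq> block_list \<tau> ! j} = psi_partition (block_list \<tau> ! j) (\<sigma>s ! j)"
    and "\<And>B. B \<in> \<tau> \<Longrightarrow> connected_on B {X \<in> Psi (\<tau>, \<sigma>s). X \<subseteq> B}"
proof -
  show \<tau>: "\<tau> \<in> NC_on {1..n}" and "length \<sigma>s = card \<tau>"
    and \<sigma>s: "\<And>j. j < card \<tau> \<Longrightarrow> \<sigma>s ! j \<in> CO (card (block_list \<tau> ! j))"
    using assms by (auto simp: Psi_dom_def NC_eq_NC_on)
  have p: "partition_on {1..n} \<tau>" using \<tau> by (simp add: NC_on_def)
  show bij: "bij_betw (\<lambda>j. block_list \<tau> ! j) {..<card \<tau>} \<tau>"
    by (rule block_list_bij_betw[OF _ p]) simp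
  show fin: "finite (block_list \<tau> ! j)" if "j < card \<tau>" for j
  proof -
    have "block_list \<tau> ! j \<in> \<tau>" using bij that by (auto simp: bij_betw_def)
    then show ?thesis using partition_on_finite_block[OF _ p] by simp
  qed
  have con: "connected_on (block_list \<tau> ! j) (psi_partition (block_list \<tau> ! j) (\<sigma>s ! j))"
    if "j < card \<tau>" for j
    using psi_partition_bij_betw[OF fin[OF that]] \<sigma>s[OF that] by (auto simp: bij_betw_def)
  have Psi: "Psi (\<tau>, \<sigma>s) = (\<Union>j\<in>{..<card \<tau>}. psi_partition (block_list \<tau> ! j) (\<sigma>s ! j))"
    by (simp add: Psi_def)
  have R: "partition_on (block_list \<tau> ! j) (psi_partition (block_list \<tau> ! j) (\<sigma>s ! j))"
    if "j \<in> {..<card \<tau>}" for j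
    using con that by (simp add: connected_on_def)
  show "partition_on {1..n} (Psi (\<tau>, \<sigma>s))"
    unfolding Psi using R by (rule partition_on_glue(1)[OF p bij])
  show eq: "{X \<in> Psi (\<tau>, \<sigma>s). X \<subseteq> block_list \<tau> ! j} = psi_partition (block_list \<tau> ! j) (\<sigma>s ! j)"
    if "j < card \<tau>" for j
    unfolding Psi using partition_on_glue(2)[OF p bij R] that by simp
  show "connected_on B {X \<in> Psi (\<tau>, \<sigma>s). X \<subseteq> B}" if "B \<in> \<tau>" for B
  proof -
    obtain j where "j < card \<tau>" "B = block_list \<tau> ! j"
      using bij_betw_imp_surj_on[OF bij] \<open>B \<in> \<tau>\<close> by blast
    then show ?thesis using con eq by simp
  qed
qed

text \<open>The inverse sends \<open>\<pi>\<close> to its noncrossing closure \<open>\<tau>\<close>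
  together with the restrictions of \<open>\<pi>\<close> to the blocks of \<open>\<tau>\<close>,
  relabelled. Uniqueness of the closure gives injectivity, existence gives surjectivity.\<close>

lemma Psi_bij_betw:
  assumes "n \<ge> 1"
  shows "bij_betw Psi (Psi_dom n) (set_partitions n)"
  unfolding bij_betw_def
proof (intro conjI equalityI subsetI inj_onI)
  fix x y assume x: "x \<in> Psi_dom n" and y: "y \<in> Psi_dom n" and eq: "Psi x = Psi y"
  obtain \<tau> \<sigma>s \<tau>' \<sigma>s' where xy: "x = (\<tau>, \<sigma>s)" "y = (\<tau>', \<sigma>s')" by (cases x, cases y)
  note X = Psi_dom_components[OF x[unfolded xy]] and Y = Psi_dom_components[OF y[unfolded xy]]
  have eq': "Psi (\<tau>, \<sigma>s) = Psi (\<tau>', \<sigma>s')" using eq xy by simp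
  have \<tau>: "\<tau> = \<tau>'"
    by (rule noncrossing_closure_unique[OF _ X(6) X(1) X(8) Y(1) Y(8)[folded eq']]) simp_all
  have "\<sigma>s ! j = \<sigma>s' ! j" if j: "j < card \<tau>" for j
  proof -
    have "psi_partition (block_list \<tau> ! j) (\<sigma>s ! j) = psi_partition (block_list \<tau> ! j) (\<sigma>s' ! j)"
      using X(7)[of j] Y(7)[of j] j \<tau> eq' by simp
    moreover have "inj_on (psi_partition (block_list \<tau> ! j)) (CO (card (block_list \<tau> ! j)))"
      using psi_partition_bij_betw[OF X(4)[OF j]] by (simp add: bij_betw_def)
    ultimately show ?thesis using X(5)[OF j] Y(5)[of j] j \<tau> by (auto dest: inj_onD)
  qed
  then have "\<sigma>s = \<sigma>s'" using X(2) Y(2) \<tau> by (intro nth_equalityI) auto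
  with \<tau> xy show "x = y" by simp
next
  fix \<pi> assume "\<pi> \<in> Psi ` Psi_dom n"
  then show "\<pi> \<in> set_partitions n" using Psi_dom_components(6) by (auto simp: set_partitions_def)
next
  fix \<pi> assume "\<pi> \<in> set_partitions n"
  then have \<pi>: "partition_on {1..n} \<pi>" by (simp add: set_partitions_def)
  obtain \<tau> where \<tau>: "\<tau> \<in> NC_on {1..n}" "\<And>B. B \<in> \<tau> \<Longrightarrow> connected_on B {X \<in> \<pi>. X \<subseteq> B}"
    using noncrossing_closure_exists[OF _ _ \<pi>] assms by auto
  have p: "partition_on {1..n} \<tau>" using \<tau> by (simp add: NC_on_def)
  have bij: "bij_betw (\<lambda>j. block_list \<tau> ! j) {..<card \<tau>} \<tau>"
    by (rule block_list_bij_betw[OF _ p]) simp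
  have "\<exists>\<sigma>\<in>CO (card (block_list \<tau> ! j)). psi_partition (block_list \<tau> ! j) \<sigma> = {X \<in> \<pi>. X \<subseteq> block_list \<tau> ! j}"
    if "j < card \<tau>" for j
  proof -
    have B: "block_list \<tau> ! j \<in> \<tau>" using bij that by (auto simp: bij_betw_def)
    then have "finite (block_list \<tau> ! j)" using partition_on_finite_block[OF _ p] by simp
    from psi_partition_bij_betw[OF this] \<tau>(2)[OF B] show ?thesis
      unfolding bij_betw_def by (metis (no_types, lifting) imageE mem_Collect_eq)
  qed
  then obtain s where s: "\<And>j. j < card \<tau> \<Longrightarrow> s j \<in> CO (card (block_list \<tau> ! j))"
    "\<And>j. j < card \<tau> \<Longrightarrow> psi_partition (block_list \<tau> ! j) (s j) = {X \<in> \<pi>. X \<subseteq> block_list \<tau> ! j}"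
    by metis
  define \<sigma>s where "\<sigma>s = map s [0..<card \<tau>]"
  have dom: "(\<tau>, \<sigma>s) \<in> Psi_dom n"
    using \<tau>(1) s(1) by (auto simp: Psi_dom_def NC_eq_NC_on \<sigma>s_def)
  have "Psi (\<tau>, \<sigma>s) = (\<Union>j<card \<tau>. {X \<in> \<pi>. X \<subseteq> block_list \<tau> ! j})"
    using s(2) by (simp add: Psi_def \<sigma>s_def)
  also have "\<dots> = (\<Union>B\<in>\<tau>. {X \<in> \<pi>. X \<subseteq> B})"
    by (subst (3) bij_betw_imp_surj_on[OF bij, symmetric]) simp
  \<comment> \<open>A point of \<open>X\<close> lies in some \<open>B \<in> \<tau>\<close>, which is
    a union of blocks of \<open>\<pi>\<close>; the one containing the point must be
    \<open>X\<close>, so \<open>X \<subseteq> B\<close>.\<close>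
  also have "\<dots> = \<pi>"
  proof (intro equalityI subsetI)
    fix X assume X: "X \<in> \<pi>"
    obtain x where x: "x \<in> X" using partition_onD3[OF \<pi>] X by (metis all_not_in_conv)
    then obtain B where B: "B \<in> \<tau>" "x \<in> B"
      using X partition_onD1[OF p] partition_onD1[OF \<pi>] by blast
    have "partition_on B {X \<in> \<pi>. X \<subseteq> B}" using \<tau>(2)[OF B(1)] by (simp add: connected_on_def)
    then obtain X' where "X' \<in> \<pi>" "X' \<subseteq> B" "x \<in> X'" using partition_onD1 B by blast
    then show "X \<in> (\<Union>B\<in>\<tau>. {X \<in> \<pi>. X \<subseteq> B})"
      using partition_on_unique_block[OF \<pi> X, of X' x] x B by auto
  qed auto
  finally show "\<pi> \<in> Psi ` Psi_dom n" using dom by (metis image_eqI)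
qed

section \<open>Recursive structure of noncrossing partitions\<close>

text \<open>The root \<open>V\<close> is the block of \<open>m\<close>; it is empty exactly when the interval \<open>{m..<n}\<close> is.  Admitting
  the empty root makes the recursion below uniform: deleting \<open>m\<close> from its block leaves the
  root of a shorter interval even if \<open>{m}\<close> was a singleton block.\<close>
definition rooted_NC :: "nat \<Rightarrow> nat \<Rightarrow> (nat set \<times> nat set set) set" where
  "rooted_NC m n = {(V, \<rho>). V \<subseteq> {m..<n} \<and> partition_on ({m..<n} - V) \<rho> \<and>
     noncrossing (insert V \<rho>) \<and> (m < n \<longrightarrow> m \<in> V)}"

lemma noncrossing_mono:
  assumes "noncrossing \<pi>" "\<rho> \<subseteq> \<pi>"
  shows "noncrossing \<rho>"
  using assms unfolding noncrossing_def by (meson subsetD)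

lemma NC_on_empty: "NC_on {} = {{}}"
  by (auto simp: NC_on_def partition_on_empty noncrossing_def)

lemma rooted_NC_empty: "rooted_NC n n = {({}, {})}"
  by (auto simp: rooted_NC_def partition_on_empty noncrossing_def)

text \<open>On a nonempty interval the root has to be the block of \<open>m\<close>, so marking it
  adds no data. The union in the inverse map merely extracts the unique block containing
  \<open>m\<close>.\<close>

lemma rooted_NC_bij_betw:
  assumes "m < n"
  shows "bij_betw (\<lambda>(V, \<rho>). insert V \<rho>) (rooted_NC m n) (NC_on {m..<n})"
proof (rule bij_betw_byWitness[where f' = "\<lambda>\<pi>. (\<Union>{B \<in> \<pi>. m \<in> B}, {B \<in> \<pi>. m \<notin> B})"])
  have mV: "m \<in> V" "m \<notin> \<Union>\<rho>" "V \<subseteq> {m..<n}" "partition_on ({m..<n} - V) \<rho>" "noncrossing (insert V \<rho>)"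
    if "(V, \<rho>) \<in> rooted_NC m n" for V \<rho>
  proof -
    show *: "m \<in> V" "V \<subseteq> {m..<n}" "partition_on ({m..<n} - V) \<rho>" "noncrossing (insert V \<rho>)"
      using that assms by (auto simp: rooted_NC_def)
    show "m \<notin> \<Union>\<rho>" using partition_onD1[OF *(3)] *(1) by blast
  qed
  show "\<forall>x\<in>rooted_NC m n. (\<Union>{B \<in> (case x of (V, \<rho>) \<Rightarrow> insert V \<rho>). m \<in> B},
      {B \<in> (case x of (V, \<rho>) \<Rightarrow> insert V \<rho>). m \<notin> B}) = x"
    using mV by fastforce
  show "(\<lambda>(V, \<rho>). insert V \<rho>) ` rooted_NC m n \<subseteq> NC_on {m..<n}"
  proof clarify
    fix V \<rho> assume r: "(V, \<rho>) \<in> rooted_NC m n"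
    have "disjnt V (\<Union>\<rho>)" using partition_onD1[OF mV(4)[OF r]] by (auto simp: disjnt_def)
    then show "insert V \<rho> \<in> NC_on {m..<n}"
      using mV[OF r] by (auto simp: NC_on_def partition_on_insert)
  qed
  have blk: "\<exists>V. V \<in> \<pi> \<and> m \<in> V \<and> {B \<in> \<pi>. m \<in> B} = {V} \<and> {B \<in> \<pi>. m \<notin> B} = \<pi> - {V}"
    if "\<pi> \<in> NC_on {m..<n}" for \<pi>
  proof -
    have p: "partition_on {m..<n} \<pi>" using that by (simp add: NC_on_def)
    obtain V where V: "V \<in> \<pi>" "m \<in> V" using partition_onD1[OF p] assms by (metis UnionE atLeastLessThan_iff order_refl)
    then have "{B \<in> \<pi>. m \<in> B} = {V}" using partition_on_unique_block[OF p] by blast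
    then show ?thesis using V by blast
  qed
  show "\<forall>\<pi>\<in>NC_on {m..<n}. (case (\<Union>{B \<in> \<pi>. m \<in> B}, {B \<in> \<pi>. m \<notin> B}) of (V, \<rho>) \<Rightarrow> insert V \<rho>) = \<pi>"
    using blk by (auto; force)
  show "(\<lambda>\<pi>. (\<Union>{B \<in> \<pi>. m \<in> B}, {B \<in> \<pi>. m \<notin> B})) ` NC_on {m..<n} \<subseteq> rooted_NC m n"
  proof clarify
    fix \<pi> assume \<pi>: "\<pi> \<in> NC_on {m..<n}"
    then have p: "partition_on {m..<n} \<pi>" and nc: "noncrossing \<pi>" by (auto simp: NC_on_def)
    obtain V where V: "V \<in> \<pi>" "m \<in> V" "{B \<in> \<pi>. m \<in> B} = {V}" "{B \<in> \<pi>. m \<notin> B} = \<pi> - {V}"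
      using blk[OF \<pi>] by blast
    have ins: "insert V (\<pi> - {V}) = \<pi>" using V(1) by blast
    have "disjnt V (\<Union>(\<pi> - {V}))"
      using partition_on_unique_block[OF p V(1)] by (auto simp: disjnt_def)
    then have "partition_on ({m..<n} - V) (\<pi> - {V}) \<and> V \<subseteq> {m..<n}"
      using partition_on_insert[of V "\<pi> - {V}" "{m..<n}"] p ins by simp
    then show "(\<Union>{B \<in> \<pi>. m \<in> B}, {B \<in> \<pi>. m \<notin> B}) \<in> rooted_NC m n"
      using V nc ins by (simp add: rooted_NC_def)
  qed
qed

section \<open>Cutting at the second element of the root\<close>

lemma partition_on_Un:
  assumes "partition_on A \<pi>" "partition_on B \<rho>" "A \<inter> B = {}"
  shows "partition_on (A \<union> B) (\<pi> \<union> \<rho>)"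
proof (rule partition_onI)
  have AB: "A = \<Union>\<pi>" "B = \<Union>\<rho>" using assms(1,2) by (auto dest: partition_onD1)
  then show "\<Union>(\<pi> \<union> \<rho>) = A \<union> B" by simp
  show "{} \<notin> \<pi> \<union> \<rho>" using assms(1,2) by (auto dest: partition_onD3)
  fix X Y assume XY: "X \<in> \<pi> \<union> \<rho>" "Y \<in> \<pi> \<union> \<rho>" "X \<noteq> Y"
  consider "X \<in> \<pi>" "Y \<in> \<pi>" | "X \<in> \<rho>" "Y \<in> \<rho>" | "X \<subseteq> A" "Y \<subseteq> B" | "X \<subseteq> B" "Y \<subseteq> A"
    using XY AB by blast
  then show "disjnt X Y"
  proof cases
    case 1 then show ?thesis using partition_onD2[OF assms(1)] XY(3) by (simp add: pairwiseD)
  next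
    case 2 then show ?thesis using partition_onD2[OF assms(2)] XY(3) by (simp add: pairwiseD)
  next
    case 3 then show ?thesis using assms(3) by (auto simp: disjnt_def)
  next
    case 4 then show ?thesis using assms(3) by (auto simp: disjnt_def)
  qed
qed

text \<open>\<open>k\<close> is the second element of the root block, or \<open>n\<close> if there is none.\<close>
lemma rooted_NC_rec_mem:
  assumes k: "m < k" "k \<le> n" and \<rho>1: "\<rho>1 \<in> NC_on {Suc m..<k}" and r: "(V, \<rho>2) \<in> rooted_NC k n"
  shows "(insert m V, \<rho>1 \<union> \<rho>2) \<in> rooted_NC m n"
proof -
  have p1: "partition_on {Suc m..<k} \<rho>1" and nc1: "noncrossing \<rho>1" using \<rho>1 by (auto simp: NC_on_def)
  have V: "V \<subseteq> {k..<n}" and p2: "partition_on ({k..<n} - V) \<rho>2" and nc2: "noncrossing (insert V \<rho>2)"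
    and kV: "k < n \<Longrightarrow> k \<in> V"
    using r by (auto simp: rooted_NC_def)
  have "x \<in> {m..<n} - insert m V \<longleftrightarrow> x \<in> {Suc m..<k} \<union> ({k..<n} - V)" for x
    using V k by (auto simp: subset_iff)
  then have "{m..<n} - insert m V = {Suc m..<k} \<union> ({k..<n} - V)" by blast
  moreover have "{Suc m..<k} \<inter> ({k..<n} - V) = {}" by auto
  ultimately have p: "partition_on ({m..<n} - insert m V) (\<rho>1 \<union> \<rho>2)"
    using partition_on_Un[OF p1 p2] by simp
  have e1: "m < x \<and> x < k" if "x \<in> B" "B \<in> \<rho>1" for x B
    using partition_onD1[OF p1] that by (metis Suc_le_eq UnionI atLeastLessThan_iff)
  have e2: "k \<le> x \<and> x < n \<and> x \<notin> V" if "x \<in> B" "B \<in> \<rho>2" for x B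
    using partition_onD1[OF p2] that by (metis DiffE UnionI atLeastLessThan_iff)
  have eV: "k \<le> x \<and> x < n \<and> k \<in> V" if "x \<in> V" for x using V kV that by force
  have "noncrossing (insert (insert m V) (\<rho>1 \<union> \<rho>2))"
    unfolding noncrossing_def
  proof (intro ballI allI impI, elim conjE)
    fix B C h i j l
    assume B: "B \<in> insert (insert m V) (\<rho>1 \<union> \<rho>2)" and C: "C \<in> insert (insert m V) (\<rho>1 \<union> \<rho>2)"
      and lt: "h < i" "i < j" "j < l" and mem: "h \<in> B" "j \<in> B" "i \<in> C" "l \<in> C"
    consider "B \<in> \<rho>1" | "B \<in> \<rho>2" | "B = insert m V" using B by blast
    then show "B = C"
    proof cases
      \<comment> \<open>\<open>B\<close> lies in the gap between \<open>m\<close> and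
        \<open>k\<close>, hence so does \<open>i\<close>, and \<open>C\<close> must come from
        \<open>\<rho>1\<close> as well.\<close>
      case 1
      have "m < h" "h < k" "j < k" using e1[OF mem(1) 1] e1[OF mem(2) 1] by auto
      then have "i \<noteq> m" "\<not> k \<le> i" using lt by auto
      then have "C \<in> \<rho>1" using C mem(3) e2 eV by blast
      then show ?thesis using noncrossingD[OF nc1 1 _ lt mem] by simp
    next
      \<comment> \<open>All four points are at least \<open>k\<close>, so a crossing with the root
        would already be a crossing with \<open>V\<close>.\<close>
      case 2
      have h: "k \<le> h" using e2[OF mem(1) 2] by auto
      then have "C \<notin> \<rho>1" using e1[OF mem(3)] lt by fastforce
      moreover have False if "C = insert m V"
      proof -
        have "i \<in> V" "l \<in> V" using mem h lt k that by auto
        then have "B = V" using noncrossingD[OF nc2 _ _ lt mem(1,2)] 2 by blast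
        then show False using e2[OF mem(1) 2] mem by blast
      qed
      ultimately have "C \<in> \<rho>2" using C by blast
      then show ?thesis using noncrossingD[OF nc2 _ _ lt mem] 2 by blast
    next
      case 3
      have "m \<le> h" using 3 mem(1) eV k by fastforce
      then have jV: "j \<in> V" using 3 mem(2) lt by auto
      then have kV: "k \<in> V" "k \<le> j" using eV by auto
      show ?thesis
      proof (rule ccontr)
        assume ne: "B \<noteq> C"
        have "C \<notin> \<rho>1" using e1[OF mem(4)] lt kV by fastforce
        then have C2: "C \<in> \<rho>2" using C ne 3 by blast
        have iV: "k \<le> i" "i \<notin> V" using e2[OF mem(3) C2] by auto
        \<comment> \<open>\<open>m\<close> is not in \<open>V\<close>, so the crossing is restarted
          at \<open>k\<close>, which belongs to \<open>V\<close> and lies before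
          \<open>i\<close>.\<close>
        then have ki: "k < i" using kV by (metis le_neq_implies_less)
        have "V = C" using noncrossingD[OF nc2 _ _ ki lt(2,3) kV(1) jV mem(3,4)] C2 by blast
        then show False using iV mem by blast
      qed
    qed
  qed
  then show ?thesis using p V k by (auto simp: rooted_NC_def)
qed

text \<open>If \<open>k < n\<close>, the root contains \<open>m\<close> and \<open>k\<close>, so a
  further block with points on both sides of \<open>k\<close> would cross it. The other blocks
  therefore separate into those in the gap before \<open>k\<close> and those after it; for
  \<open>k = n\<close> all of them lie in the gap.\<close>

lemma rooted_NC_decompose:
  assumes mn: "m < n" and r: "(V, \<rho>) \<in> rooted_NC m n"
    and k_def: "k = Min (insert n (V - {m}))"
  shows "k \<in> {m<..n}" "{B \<in> \<rho>. B \<subseteq> {Suc m..<k}} \<in> NC_on {Suc m..<k}"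
    "(V - {m}, {B \<in> \<rho>. B \<subseteq> {k..<n}}) \<in> rooted_NC k n"
    "{B \<in> \<rho>. B \<subseteq> {Suc m..<k}} \<union> {B \<in> \<rho>. B \<subseteq> {k..<n}} = \<rho>"
proof -
  have V: "V \<subseteq> {m..<n}" and p: "partition_on ({m..<n} - V) \<rho>" and nc: "noncrossing (insert V \<rho>)"
    and mV: "m \<in> V"
    using r mn by (auto simp: rooted_NC_def)
  have fin: "finite (insert n (V - {m}))" using V finite_subset by fastforce
  have kin: "k \<in> insert n (V - {m})" unfolding k_def using fin by (intro Min_in) auto
  have kle: "k \<le> x" if "x \<in> V - {m}" for x unfolding k_def using fin that by (intro Min_le) auto
  have kn: "k \<le> n" unfolding k_def using fin by (intro Min_le) auto
  show k: "k \<in> {m<..n}" using kin V mn kn by auto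
  have kV: "k \<in> V" if "k < n" using kin that by auto
  have el: "m < x \<and> x < n \<and> x \<notin> V" if "x \<in> B" "B \<in> \<rho>" for x B
  proof -
    have "x \<in> {m..<n} - V" using partition_onD1[OF p] that by blast
    then show ?thesis using mV by (metis DiffE atLeastLessThan_iff le_neq_implies_less)
  qed
  have dich: "B \<subseteq> {Suc m..<k} \<or> B \<subseteq> {k..<n}" if B: "B \<in> \<rho>" for B
  proof (rule ccontr)
    assume n: "\<not> ?thesis"
    obtain x where x: "x \<in> B" "x < k" using n el[OF _ B] by (auto simp: subset_iff not_le)
    obtain y where y: "y \<in> B" "k \<le> y" using n el[OF _ B] by (auto simp: subset_iff Suc_le_eq)
    have "k < n" using y el[OF y(1) B] by linarith
    then have "k \<in> V" by (rule kV)
    then have "k < y" using y el[OF y(1) B] by (metis le_neq_implies_less)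
    then have "V = B"
      using noncrossingD[OF nc _ _ _ x(2) \<open>k < y\<close> mV \<open>k \<in> V\<close> x(1) y(1)] el[OF x(1) B] B by blast
    then show False using el[OF x(1) B] x by blast
  qed
  then show "{B \<in> \<rho>. B \<subseteq> {Suc m..<k}} \<union> {B \<in> \<rho>. B \<subseteq> {k..<n}} = \<rho>" by blast
  have Vk: "V - {m} \<subseteq> {k..<n}" using kle subsetD[OF V] by fastforce
  \<comment> \<open>A set that no block cuts is partitioned by the blocks it contains; this serves
    for both sides of \<open>k\<close>.\<close>
  have sub: "partition_on S {B \<in> \<rho>. B \<subseteq> S}"
    if S: "S \<subseteq> {m..<n} - V" "\<And>B. B \<in> \<rho> \<Longrightarrow> B \<subseteq> S \<or> B \<inter> S = {}" for S
  proof (rule partition_onI)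
    show "\<Union>{B \<in> \<rho>. B \<subseteq> S} = S"
    proof (intro equalityI subsetI)
      fix x assume x: "x \<in> S"
      then obtain B where "B \<in> \<rho>" "x \<in> B" using S(1) partition_onD1[OF p] by blast
      then show "x \<in> \<Union>{B \<in> \<rho>. B \<subseteq> S}" using S(2) x by blast
    qed auto
    show "disjnt B C" if "B \<in> {B \<in> \<rho>. B \<subseteq> S}" "C \<in> {B \<in> \<rho>. B \<subseteq> S}" "B \<noteq> C" for B C
      using partition_onD2[OF p] that by (auto simp: pairwise_def)
    show "{} \<notin> {B \<in> \<rho>. B \<subseteq> S}" using partition_onD3[OF p] by auto
  qed
  have "partition_on {Suc m..<k} {B \<in> \<rho>. B \<subseteq> {Suc m..<k}}"
  proof (rule sub)
    show "{Suc m..<k} \<subseteq> {m..<n} - V" using kn kle by fastforce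
    show "B \<subseteq> {Suc m..<k} \<or> B \<inter> {Suc m..<k} = {}" if "B \<in> \<rho>" for B
      using dich[OF that] by fastforce
  qed
  moreover have "noncrossing {B \<in> \<rho>. B \<subseteq> {Suc m..<k}}"
    by (rule noncrossing_mono[OF nc]) auto
  ultimately show "{B \<in> \<rho>. B \<subseteq> {Suc m..<k}} \<in> NC_on {Suc m..<k}"
    by (simp add: NC_on_def)
  have el2: "B \<subseteq> {k..<n} - V" if "B \<in> \<rho>" "B \<subseteq> {k..<n}" for B
    using el that by blast
  have "partition_on ({k..<n} - V) {B \<in> \<rho>. B \<subseteq> {k..<n} - V}"
  proof (rule sub)
    show "{k..<n} - V \<subseteq> {m..<n} - V" using k by auto
    show "B \<subseteq> {k..<n} - V \<or> B \<inter> ({k..<n} - V) = {}" if "B \<in> \<rho>" for B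
      using dich[OF that] el2[OF that] by fastforce
  qed
  moreover have "{B \<in> \<rho>. B \<subseteq> {k..<n} - V} = {B \<in> \<rho>. B \<subseteq> {k..<n}}" using el2 by blast
  moreover have "{k..<n} - V = {k..<n} - (V - {m})" using k by auto
  ultimately have "partition_on ({k..<n} - (V - {m})) {B \<in> \<rho>. B \<subseteq> {k..<n}}" by metis
  moreover have "noncrossing (insert (V - {m}) {B \<in> \<rho>. B \<subseteq> {k..<n}})"
    unfolding noncrossing_def
  proof (intro ballI allI impI, elim conjE)
    fix B C h i j l
    assume B: "B \<in> insert (V - {m}) {B \<in> \<rho>. B \<subseteq> {k..<n}}" and C: "C \<in> insert (V - {m}) {B \<in> \<rho>. B \<subseteq> {k..<n}}"
      and lt: "h < i" "i < j" "j < l" and mem: "h \<in> B" "j \<in> B" "i \<in> C" "l \<in> C"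
    \<comment> \<open>Each member arises from a member of \<open>insert V \<rho>\<close> by deleting
      \<open>m\<close>, since the blocks in \<open>\<rho>\<close> do not contain \<open>m\<close>. A
      crossing therefore lifts to the old family.\<close>
    obtain B' where B': "B' \<in> insert V \<rho>" "B \<subseteq> B'" "B = B' - {m}"
      using B el by blast
    obtain C' where C': "C' \<in> insert V \<rho>" "C \<subseteq> C'" "C = C' - {m}"
      using C el by blast
    have "B' = C'" using noncrossingD[OF nc B'(1) C'(1) lt] mem B' C' by blast
    then show "B = C" using B' C' by simp
  qed
  ultimately show "(V - {m}, {B \<in> \<rho>. B \<subseteq> {k..<n}}) \<in> rooted_NC k n"
    using Vk kV k by (auto simp: rooted_NC_def)
qed

text \<open>Gluing and cutting are mutually inverse: \<open>k\<close> is the least element of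
  \<open>V\<close>, or \<open>n\<close> if \<open>V\<close> is empty, and every other block is
  recovered by the side of \<open>k\<close> on which it lies.\<close>

lemma rooted_NC_rec_bij_betw:
  assumes mn: "m < n"
  shows "bij_betw (\<lambda>(k, \<rho>1, V, \<rho>2). (insert m V, \<rho>1 \<union> \<rho>2))
    (SIGMA k:{m<..n}. NC_on {Suc m..<k} \<times> rooted_NC k n) (rooted_NC m n)"
proof (rule bij_betw_byWitness[where f' = "\<lambda>(V, \<rho>). let k = Min (insert n (V - {m})) in
    (k, {B \<in> \<rho>. B \<subseteq> {Suc m..<k}}, V - {m}, {B \<in> \<rho>. B \<subseteq> {k..<n}})"])
  let ?f = "\<lambda>(k, \<rho>1, V, \<rho>2). (insert m V, \<rho>1 \<union> \<rho>2)"
  let ?g = "\<lambda>(V, \<rho>). let k = Min (insert n (V - {m})) in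
    (k, {B \<in> \<rho>. B \<subseteq> {Suc m..<k}}, V - {m}, {B \<in> \<rho>. B \<subseteq> {k..<n}})"
  let ?S = "SIGMA k:{m<..n}. NC_on {Suc m..<k} \<times> rooted_NC k n"
  show "\<forall>x\<in>?S. ?g (?f x) = x"
  proof
    fix x assume xS: "x \<in> ?S"
    obtain k \<rho>1 V \<rho>2 where x: "x = (k, \<rho>1, V, \<rho>2)" by (cases x rule: prod_cases4)
    have k: "k \<in> {m<..n}" and \<rho>1: "\<rho>1 \<in> NC_on {Suc m..<k}" and r: "(V, \<rho>2) \<in> rooted_NC k n"
      using xS unfolding x by (simp_all only: mem_Sigma_iff)
    have p1: "partition_on {Suc m..<k} \<rho>1" using \<rho>1 by (auto simp: NC_on_def)
    have V: "V \<subseteq> {k..<n}" and p2: "partition_on ({k..<n} - V) \<rho>2" and kV: "k < n \<Longrightarrow> k \<in> V"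
      using r by (auto simp: rooted_NC_def)
    have mV: "insert m V - {m} = V" using V k by auto
    have "finite V" using V finite_subset by blast
    then have Min: "Min (insert n V) = k"
      using V k kV by (intro Min_eqI) (auto simp: le_less)
    have b1: "B \<subseteq> {Suc m..<k}" "B \<noteq> {}" if "B \<in> \<rho>1" for B
      using that p1 by (auto simp: partition_on_def)
    have b2: "B \<subseteq> {k..<n}" "B \<noteq> {}" if "B \<in> \<rho>2" for B
      using that p2 by (auto simp: partition_on_def)
    have disj: "{Suc m..<k} \<inter> {k..<n} = {}" by auto
    have "\<not> B \<subseteq> {k..<n}" if "B \<in> \<rho>1" for B
      using b1[OF that] disj by (metis Int_greatest subset_empty)
    moreover have "\<not> B \<subseteq> {Suc m..<k}" if "B \<in> \<rho>2" for B
      using b2[OF that] disj by (metis Int_greatest subset_empty)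
    ultimately have "{B \<in> \<rho>1 \<union> \<rho>2. B \<subseteq> {Suc m..<k}} = \<rho>1" "{B \<in> \<rho>1 \<union> \<rho>2. B \<subseteq> {k..<n}} = \<rho>2"
      using b1(1) b2(1) by (simp_all only: set_eq_iff mem_Collect_eq Un_iff) metis+
    then show "?g (?f x) = x"
      by (simp only: x prod.case mV Min Let_def)
  qed
  show "\<forall>y\<in>rooted_NC m n. ?f (?g y) = y"
  proof
    fix y assume y: "y \<in> rooted_NC m n"
    obtain V \<rho> where VR: "y = (V, \<rho>)" by (cases y)
    have r: "(V, \<rho>) \<in> rooted_NC m n" using y VR by simp
    have "insert m (V - {m}) = V" using r mn by (auto simp: rooted_NC_def)
    then show "?f (?g y) = y"
      by (simp only: VR prod.case Let_def rooted_NC_decompose(4)[OF mn r refl])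
  qed
  show "?f ` ?S \<subseteq> rooted_NC m n"
  proof (rule image_subsetI)
    fix x assume xS: "x \<in> ?S"
    obtain k \<rho>1 V \<rho>2 where x: "x = (k, \<rho>1, V, \<rho>2)" by (cases x rule: prod_cases4)
    have "m < k" "k \<le> n" "\<rho>1 \<in> NC_on {Suc m..<k}" "(V, \<rho>2) \<in> rooted_NC k n"
      using xS unfolding x by (simp_all only: mem_Sigma_iff greaterThanAtMost_iff)
    from rooted_NC_rec_mem[OF this] show "?f x \<in> rooted_NC m n" by (simp only: x prod.case)
  qed
  show "?g ` rooted_NC m n \<subseteq> ?S"
  proof (rule image_subsetI)
    fix y assume y: "y \<in> rooted_NC m n"
    obtain V \<rho> where VR: "y = (V, \<rho>)" by (cases y)
    have r: "(V, \<rho>) \<in> rooted_NC m n" using y VR by simp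
    note * = rooted_NC_decompose[OF mn r refl]
    show "?g y \<in> ?S"
      by (simp only: VR prod.case Let_def mem_Sigma_iff *(1-3) simp_thms)
  qed
qed

section \<open>Generating series\<close>

unbundle fps_syntax

section \<open>Weighted sums over noncrossing partitions\<close>

lemma finite_NC_on: "finite A \<Longrightarrow> finite (NC_on A)"
  unfolding NC_on_def using finitely_many_partition_on[of A] by (rule rev_finite_subset) auto

lemma finite_rooted_NC: "finite (rooted_NC m n)"
proof (rule finite_subset)
  show "rooted_NC m n \<subseteq> Pow {m..<n} \<times> Pow (Pow {m..<n})"
    by (auto simp: rooted_NC_def partition_on_def)
qed simp

definition NC_sum :: "(nat \<Rightarrow> 'a::comm_semiring_1) \<Rightarrow> nat set \<Rightarrow> 'a" where
  "NC_sum f A = (\<Sum>\<pi>\<in>NC_on A. \<Prod>B\<in>\<pi>. f (card B))"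

text \<open>For \<open>m = 0\<close> this is the coefficient of degree \<open>n\<close> in
  \<open>H\<^sub>t\<close>. The shift \<open>t\<close> acts on the root only, and an empty root has
  weight \<open>f t\<close>.\<close>

definition rooted_sum :: "(nat \<Rightarrow> 'a::comm_semiring_1) \<Rightarrow> nat \<Rightarrow> nat \<Rightarrow> nat \<Rightarrow> 'a" where
  "rooted_sum f t m n = (\<Sum>(V, \<rho>)\<in>rooted_NC m n. f (t + card V) * (\<Prod>B\<in>\<rho>. f (card B)))"

lemma rooted_sum_empty: "rooted_sum f t n n = f t"
  by (simp add: rooted_sum_def rooted_NC_empty)

text \<open>On a nonempty interval the root is the block of \<open>m\<close>. On the empty interval
  the empty partition has weight 1 and the empty root has weight \<open>f 0\<close>, which is where
  \<open>f 0 = 1\<close> enters.\<close>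

lemma NC_sum_eq_rooted_sum:
  assumes "f 0 = 1" "m \<le> n"
  shows "NC_sum f {m..<n} = rooted_sum f 0 m n"
proof (cases "m < n")
  case False
  then show ?thesis
    using assms by (simp add: NC_sum_def NC_on_empty rooted_sum_empty)
next
  case True
  have "NC_sum f {m..<n} = (\<Sum>x\<in>rooted_NC m n. \<Prod>B\<in>(case x of (V, \<rho>) \<Rightarrow> insert V \<rho>). f (card B))"
    unfolding NC_sum_def using sum.reindex_bij_betw[OF rooted_NC_bij_betw[OF True]] by metis
  also have "\<dots> = rooted_sum f 0 m n"
    unfolding rooted_sum_def
  proof (intro sum.cong refl, clarify)
    fix V \<rho> assume "(V, \<rho>) \<in> rooted_NC m n"
    then have m: "m \<in> V" and p: "partition_on ({m..<n} - V) \<rho>" using True by (auto simp: rooted_NC_def)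
    have "V \<notin> \<rho>" using partition_onD1[OF p] m by blast
    moreover have "finite \<rho>" using finite_elements[OF _ p] by simp
    ultimately show "(\<Prod>B\<in>insert V \<rho>. f (card B)) = f (0 + card V) * (\<Prod>B\<in>\<rho>. f (card B))"
      by simp
  qed
  finally show ?thesis .
qed

text \<open>Deleting \<open>m\<close> shortens the root by one element, and passing from
  \<open>t\<close> to \<open>Suc t\<close> makes up for it. The blocks between \<open>m\<close> and
  \<open>k\<close> vary independently of the rest.\<close>

lemma rooted_sum_rec:
  assumes "m < n"
  shows "rooted_sum f t m n = (\<Sum>k\<in>{m<..n}. NC_sum f {Suc m..<k} * rooted_sum f (Suc t) k n)"
proof -
  define h where "h = (\<lambda>(V :: nat set, \<rho> :: nat set set). f (t + card V) * (\<Prod>B\<in>\<rho>. f (card B)))"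
  let ?S = "SIGMA k:{m<..n}. NC_on {Suc m..<k} \<times> rooted_NC k n"
  have "rooted_sum f t m n = (\<Sum>x\<in>rooted_NC m n. h x)"
    by (simp add: rooted_sum_def h_def)
  also have "\<dots> = (\<Sum>x\<in>?S. h (case x of (k, \<rho>1, V, \<rho>2) \<Rightarrow> (insert m V, \<rho>1 \<union> \<rho>2)))"
    by (rule sum.reindex_bij_betw[OF rooted_NC_rec_bij_betw[OF assms], symmetric])
  also have "\<dots> = (\<Sum>x\<in>?S. case x of (k, \<rho>1, V, \<rho>2) \<Rightarrow>
      (\<Prod>B\<in>\<rho>1. f (card B)) * (f (Suc t + card V) * (\<Prod>B\<in>\<rho>2. f (card B))))"
  proof (intro sum.cong refl)
    fix x assume x: "x \<in> ?S"
    obtain k \<rho>1 V \<rho>2 where x': "x = (k, \<rho>1, V, \<rho>2)" by (cases x rule: prod_cases4)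
    have k: "k \<in> {m<..n}" and \<rho>1: "\<rho>1 \<in> NC_on {Suc m..<k}" and r: "(V, \<rho>2) \<in> rooted_NC k n"
      using x unfolding x' by (simp_all only: mem_Sigma_iff)
    have p1: "partition_on {Suc m..<k} \<rho>1" using \<rho>1 by (auto simp: NC_on_def)
    have V: "V \<subseteq> {k..<n}" and p2: "partition_on ({k..<n} - V) \<rho>2"
      using r by (auto simp: rooted_NC_def)
    have "finite V" "m \<notin> V" using V k finite_subset by auto
    then have cV: "card (insert m V) = Suc (card V)" by simp
    have fin: "finite \<rho>1" "finite \<rho>2" using finite_elements[OF _ p1] finite_elements[OF _ p2] by auto
    \<comment> \<open>Blocks are nonempty and the two ground sets are disjoint; without common
      blocks the product over the union factors.\<close>
    have "\<rho>1 \<inter> \<rho>2 = {}"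
    proof (rule ccontr)
      assume "\<rho>1 \<inter> \<rho>2 \<noteq> {}"
      then obtain B where B: "B \<in> \<rho>1" "B \<in> \<rho>2" by blast
      then obtain x where "x \<in> B" using partition_onD3[OF p1] by (metis all_not_in_conv)
      then have "x \<in> {Suc m..<k}" "x \<in> {k..<n} - V"
        using B partition_onD1[OF p1] partition_onD1[OF p2] by blast+
      then show False by simp
    qed
    then have "(\<Prod>B\<in>\<rho>1 \<union> \<rho>2. f (card B)) = (\<Prod>B\<in>\<rho>1. f (card B)) * (\<Prod>B\<in>\<rho>2. f (card B))"
      using fin by (intro prod.union_disjoint)
    then show "h (case x of (k, \<rho>1, V, \<rho>2) \<Rightarrow> (insert m V, \<rho>1 \<union> \<rho>2)) = (case x of (k, \<rho>1, V, \<rho>2) \<Rightarrow>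
      (\<Prod>B\<in>\<rho>1. f (card B)) * (f (Suc t + card V) * (\<Prod>B\<in>\<rho>2. f (card B))))"
      by (simp add: x' h_def cV ac_simps)
  qed
  also have "\<dots> = (\<Sum>k\<in>{m<..n}. \<Sum>y\<in>NC_on {Suc m..<k} \<times> rooted_NC k n. case y of (\<rho>1, V, \<rho>2) \<Rightarrow>
      (\<Prod>B\<in>\<rho>1. f (card B)) * (f (Suc t + card V) * (\<Prod>B\<in>\<rho>2. f (card B))))"
    by (subst sum.Sigma) (simp_all add: finite_NC_on finite_rooted_NC)
  also have "\<dots> = (\<Sum>k\<in>{m<..n}. NC_sum f {Suc m..<k} * rooted_sum f (Suc t) k n)"
    unfolding NC_sum_def rooted_sum_def sum_product
    by (intro sum.cong refl, subst sum.cartesian_product) (auto intro!: sum.cong)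
  finally show ?thesis .
qed

section \<open>Convolution form and translation invariance\<close>

text \<open>Writing \<open>k = Suc m + i\<close>, the gap has length \<open>i\<close> and the
  remaining interval has length \<open>d - i\<close>.\<close>

lemma rooted_sum_rec_convolution:
  assumes f0: "f 0 = 1"
  shows "rooted_sum f t m (Suc (m + d)) =
    (\<Sum>i\<le>d. rooted_sum f 0 (Suc m) (Suc m + i) * rooted_sum f (Suc t) (Suc m + i) (Suc m + d))"
proof -
  have "rooted_sum f t m (Suc (m + d)) =
      (\<Sum>k\<in>{m<..Suc (m + d)}. NC_sum f {Suc m..<k} * rooted_sum f (Suc t) k (Suc (m + d)))"
    by (rule rooted_sum_rec) simp
  also have "\<dots> = (\<Sum>i\<le>d. NC_sum f {Suc m..<Suc m + i} * rooted_sum f (Suc t) (Suc m + i) (Suc (m + d)))"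
    by (rule sum.reindex_bij_witness[where i = "\<lambda>i. Suc m + i" and j = "\<lambda>k. k - Suc m"]) auto
  finally show ?thesis
    using f0 by (simp add: NC_sum_eq_rooted_sum)
qed

text \<open>Translation invariance follows from the recursion, without relabelling partitions: the
  right-hand side involves shorter intervals only, and by induction these can be moved to start at
  0.\<close>

lemma rooted_sum_shift:
  assumes f0: "f 0 = 1"
  shows "rooted_sum f t m (m + d) = rooted_sum f t 0 d"
proof (induction d arbitrary: t m rule: less_induct)
  case (less d)
  show ?case
  proof (cases d)
    case 0
    then show ?thesis by (simp add: rooted_sum_empty)
  next
    case (Suc e)
    have "rooted_sum f t m (m + d) = (\<Sum>i\<le>e. rooted_sum f 0 0 i * rooted_sum f (Suc t) 0 (e - i))" for m
    proof -
      have "rooted_sum f 0 (Suc m) (Suc m + i) * rooted_sum f (Suc t) (Suc m + i) (Suc m + e) =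
          rooted_sum f 0 0 i * rooted_sum f (Suc t) 0 (e - i)" if "i \<le> e" for i
        using less[of i 0 "Suc m"] less[of "e - i" "Suc t" "Suc m + i"] that Suc by simp
      then show ?thesis
        using rooted_sum_rec_convolution[where f = f, OF f0, of t m e] Suc by simp
    qed
    from this[of m] this[of 0] show ?thesis by simp
  qed
qed

section \<open>The power series of the rooted sums\<close>

definition rooted_fps :: "(nat \<Rightarrow> 'a::comm_ring_1) \<Rightarrow> nat \<Rightarrow> 'a fps" where
  "rooted_fps f t = Abs_fps (rooted_sum f t 0)"

text \<open>The empty root gives the constant term. In higher degrees the recursion becomes a Cauchy
  product once both intervals are moved to 0, and the factor \<open>fps_X\<close> accounts for the
  deleted element.\<close>

lemma rooted_fps_rec:
  assumes f0: "f 0 = 1"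
  shows "rooted_fps f t = fps_const (f t) + fps_X * rooted_fps f 0 * rooted_fps f (Suc t)"
proof (rule fps_ext)
  fix n
  show "rooted_fps f t $ n = (fps_const (f t) + fps_X * rooted_fps f 0 * rooted_fps f (Suc t)) $ n"
  proof (cases n)
    case 0
    then show ?thesis by (simp add: rooted_fps_def rooted_sum_empty mult.assoc)
  next
    case (Suc d)
    have "rooted_sum f 0 1 (1 + i) * rooted_sum f (Suc t) (Suc i) (Suc d) =
        rooted_sum f 0 0 i * rooted_sum f (Suc t) 0 (d - i)" if "i \<le> d" for i
      using rooted_sum_shift[where f = f, OF f0, of 0 1 i]
        rooted_sum_shift[where f = f, OF f0, of "Suc t" "Suc i" "d - i"] that
      by simp
    then have "rooted_sum f t 0 (Suc d) = (\<Sum>i\<le>d. rooted_sum f 0 0 i * rooted_sum f (Suc t) 0 (d - i))"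
      using rooted_sum_rec_convolution[where f = f, OF f0, of t 0 d] by simp
    moreover have "(fps_X * rooted_fps f 0 * rooted_fps f (Suc t)) $ Suc d = (rooted_fps f 0 * rooted_fps f (Suc t)) $ d"
      by (simp add: mult.assoc)
    ultimately show ?thesis
      unfolding Suc by (simp add: fps_mult_nth atLeast0AtMost) (simp add: rooted_fps_def)
  qed
qed

text \<open>This is \<open>N\<close> applications of the recursion. The remainder stays explicit
  because its factor \<open>F ^ N\<close> has no terms of degree below \<open>N\<close>.\<close>

lemma rooted_fps_expand:
  assumes f0: "f 0 = 1"
  defines "F \<equiv> fps_X * rooted_fps f 0"
  shows "rooted_fps f 0 = (\<Sum>t<N. fps_const (f t) * F ^ t) + F ^ N * rooted_fps f N"
proof (induction N)
  case (Suc N)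
  have "F ^ N * rooted_fps f N = fps_const (f N) * F ^ N + F ^ Suc N * rooted_fps f (Suc N)"
    unfolding F_def by (subst rooted_fps_rec[where f = f, OF f0]) (simp add: algebra_simps)
  with Suc show ?case by (simp add: add.assoc)
qed simp

lemma rooted_fps_compose:
  assumes f0: "f 0 = 1"
  shows "rooted_fps f 0 = Abs_fps f oo (fps_X * rooted_fps f 0)"
proof (rule fps_ext)
  fix n
  let ?F = "fps_X * rooted_fps f 0"
  \<comment> \<open>With \<open>N = Suc n\<close> the remainder is divisible by
    \<open>fps_X ^ Suc n\<close>, and the surviving terms are exactly those in the coefficient
    formula for composition.\<close>
  have "(?F ^ Suc n * rooted_fps f (Suc n)) $ n = 0"
    by (simp only: power_mult_distrib mult.assoc fps_X_power_mult_nth) simp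
  then have "rooted_fps f 0 $ n = (\<Sum>t<Suc n. fps_const (f t) * ?F ^ t) $ n"
    by (subst rooted_fps_expand[where f = f, OF f0, of "Suc n"]) simp
  also have "\<dots> = (\<Sum>t\<in>{0..n}. f t * (?F ^ t) $ n)"
    by (simp only: fps_sum_nth fps_mult_left_const_nth lessThan_Suc_atMost atLeast0AtMost)
  finally show "rooted_fps f 0 $ n = (Abs_fps f oo ?F) $ n"
    by (simp add: fps_compose_nth)
qed

section \<open>From the weights d to noncrossing sums\<close>

text \<open>The distributive law with choices stored in lists, as in \<open>Psi_dom\<close>; it is
  transferred from dependent functions on \<open>{..<m}\<close>.\<close>

lemma prod_sum_lists:
  fixes h :: "nat \<Rightarrow> 'b \<Rightarrow> 'c::comm_semiring_1"
  assumes fin: "\<And>j. j < m \<Longrightarrow> finite (S j)"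
  shows "(\<Prod>j<m. \<Sum>y\<in>S j. h j y) =
    (\<Sum>xs\<in>{xs. length xs = m \<and> (\<forall>j<m. xs ! j \<in> S j)}. \<Prod>j<m. h j (xs ! j))"
    and "finite {xs. length xs = m \<and> (\<forall>j<m. xs ! j \<in> S j)}"
proof -
  let ?L = "{xs. length xs = m \<and> (\<forall>j<m. xs ! j \<in> S j)}"
  have bij: "bij_betw (\<lambda>g. map g [0..<m]) (PiE {..<m} S) ?L"
  proof (rule bij_betw_byWitness[where f' = "\<lambda>xs. restrict ((!) xs) {..<m}"])
    show "\<forall>g\<in>PiE {..<m} S. restrict ((!) (map g [0..<m])) {..<m} = g"
    proof (intro ballI ext)
      fix g j assume g: "g \<in> PiE {..<m} S"
      show "restrict ((!) (map g [0..<m])) {..<m} j = g j"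
      proof (cases "j < m")
        case False
        then show ?thesis using PiE_arb[OF g, of j] by simp
      qed simp
    qed
    show "\<forall>xs\<in>?L. map (restrict ((!) xs) {..<m}) [0..<m] = xs"
      by (auto intro: nth_equalityI)
    show "(\<lambda>g. map g [0..<m]) ` PiE {..<m} S \<subseteq> ?L"
      by (rule image_subsetI) (simp add: PiE_mem)
    show "(\<lambda>xs. restrict ((!) xs) {..<m}) ` ?L \<subseteq> PiE {..<m} S"
      by (rule image_subsetI) simp
  qed
  show "finite ?L"
    using bij_betw_finite[OF bij] finite_PiE[of "{..<m}" S] fin by simp
  have "(\<Prod>j<m. \<Sum>y\<in>S j. h j y) = (\<Sum>g\<in>PiE {..<m} S. \<Prod>j<m. h j (g j))"
    using fin by (intro prod_sum_PiE) auto
  also have "\<dots> = (\<Sum>g\<in>PiE {..<m} S. \<Prod>j<m. h j (map g [0..<m] ! j))"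
    by simp
  also have "\<dots> = (\<Sum>xs\<in>?L. \<Prod>j<m. h j (xs ! j))"
    by (rule sum.reindex_bij_betw[OF bij])
  finally show "(\<Prod>j<m. \<Sum>y\<in>S j. h j y) = (\<Sum>xs\<in>?L. \<Prod>j<m. h j (xs ! j))" .
qed

lemma finite_CO: "finite (CO n)"
  unfolding CO_def set_partitions_def
  using finitely_many_partition_on[of "{1..n}"] by (rule rev_finite_subset) auto

text \<open>Reindexing along \<open>Psi\<close> gives a sum over \<open>\<tau>\<close> and lists of
  connected partitions. The weight is a product over blocks, so for fixed \<open>\<tau>\<close> the
  inner sum factors. The value \<open>f 0\<close> stays free, to be set to 1 later.\<close>

lemma sum_weight_d:
  assumes n: "n \<ge> 1" and f: "\<And>k. k \<ge> 1 \<Longrightarrow> f k = (\<Sum>\<sigma>\<in>CO k. weight_c a k \<sigma>)"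
  shows "(\<Sum>\<pi>\<in>set_partitions n. weight_d a n \<pi>) = NC_sum f {1..n}"
proof -
  let ?w = "\<lambda>\<tau> \<sigma>s. \<Prod>j<card \<tau>. weight_c a (card (block_list \<tau> ! j)) (\<sigma>s ! j)"
  let ?L = "\<lambda>\<tau>. {\<sigma>s. length \<sigma>s = card \<tau> \<and> (\<forall>j<card \<tau>. \<sigma>s ! j \<in> CO (card (block_list \<tau> ! j)))}"
  note bij = Psi_bij_betw[OF n]
  have "(\<Sum>\<pi>\<in>set_partitions n. weight_d a n \<pi>) = (\<Sum>z\<in>Psi_dom n. weight_d a n (Psi z))"
    by (rule sum.reindex_bij_betw[OF bij, symmetric])
  also have "\<dots> = (\<Sum>z\<in>Psi_dom n. case z of (\<tau>, \<sigma>s) \<Rightarrow> ?w \<tau> \<sigma>s)"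
    \<comment> \<open>Injectivity of \<open>Psi\<close> lets the inverse inside
      \<open>weight_d\<close> cancel.\<close>
    using bij by (intro sum.cong refl) (simp add: weight_d_def the_inv_into_f_f bij_betw_def)
  also have "Psi_dom n = Sigma (NC n) ?L"
    by (auto simp: Psi_dom_def)
  also have "(\<Sum>z\<in>Sigma (NC n) ?L. case z of (\<tau>, \<sigma>s) \<Rightarrow> ?w \<tau> \<sigma>s) = (\<Sum>\<tau>\<in>NC n. \<Sum>\<sigma>s\<in>?L \<tau>. ?w \<tau> \<sigma>s)"
    by (rule sum.Sigma[symmetric]) (auto simp: NC_eq_NC_on finite_NC_on intro!: prod_sum_lists(2) finite_CO)
  also have "\<dots> = (\<Sum>\<tau>\<in>NC n. \<Prod>B\<in>\<tau>. f (card B))"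
  proof (rule sum.cong[OF refl])
    fix \<tau> assume "\<tau> \<in> NC n"
    then have p: "partition_on {1..n} \<tau>" by (simp add: NC_eq_NC_on NC_on_def)
    have bl: "bij_betw (\<lambda>j. block_list \<tau> ! j) {..<card \<tau>} \<tau>"
      by (rule block_list_bij_betw[OF _ p]) simp
    have "(\<Sum>\<sigma>s\<in>?L \<tau>. ?w \<tau> \<sigma>s) =
        (\<Prod>j<card \<tau>. \<Sum>\<sigma>\<in>CO (card (block_list \<tau> ! j)). weight_c a (card (block_list \<tau> ! j)) \<sigma>)"
      by (rule prod_sum_lists(1)[symmetric]) (rule finite_CO)
    also have "\<dots> = (\<Prod>B\<in>\<tau>. \<Sum>\<sigma>\<in>CO (card B). weight_c a (card B) \<sigma>)"
      by (rule prod.reindex_bij_betw[OF bl])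
    also have "\<dots> = (\<Prod>B\<in>\<tau>. f (card B))"
    proof (rule prod.cong[OF refl])
      fix B assume B: "B \<in> \<tau>"
      then have "finite B" "B \<noteq> {}"
        using partition_on_finite_block[OF _ p B] partition_onD3[OF p] by auto
      then show "(\<Sum>\<sigma>\<in>CO (card B). weight_c a (card B) \<sigma>) = f (card B)"
        using f[of "card B"] by (simp add: Suc_le_eq card_gt_0_iff)
    qed
    finally show "(\<Sum>\<sigma>s\<in>?L \<tau>. ?w \<tau> \<sigma>s) = (\<Prod>B\<in>\<tau>. f (card B))" .
  qed
  finally show ?thesis by (simp add: NC_sum_def NC_eq_NC_on)
qed

section \<open>The functional equation and the compositional inverse\<close>

lemma D_series_eq_compose:
  "D_series a = 1 + fps_compose (C_series a) (fps_X * D_series a)"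
proof -
  \<comment> \<open>The sequence of the \<open>c\<^sub>n\<close> with value 1 at 0, so that its
    generating series is \<open>1 + C_series a\<close>.\<close>
  define f where "f k = (if k = 0 then 1 else \<Sum>\<sigma>\<in>CO k. weight_c a k \<sigma>)" for k
  have f0: "f 0 = 1" by (simp add: f_def)
  have "D_series a $ n = rooted_fps f 0 $ n" for n
  proof (cases "n = 0")
    case True
    then show ?thesis by (simp add: D_series_def rooted_fps_def rooted_sum_empty f0)
  next
    case False
    \<comment> \<open>The ground set \<open>{1..n}\<close> is rewritten as
      \<open>{1..<Suc n}\<close>, to be translated to \<open>{0..<n}\<close> next.\<close>
    have "(\<Sum>\<pi>\<in>set_partitions n. weight_d a n \<pi>) = NC_sum f {1..<Suc n}"
      using sum_weight_d[of n f a] False by (simp add: f_def atLeastLessThanSuc_atLeastAtMost)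
    also have "\<dots> = rooted_sum f 0 0 n"
      using NC_sum_eq_rooted_sum[where f = f, OF f0, of 1 "Suc n"] rooted_sum_shift[where f = f, OF f0, of 0 1 n] by simp
    finally show ?thesis using False by (simp add: D_series_def rooted_fps_def)
  qed
  then have D: "D_series a = rooted_fps f 0" by (rule fps_ext)
  have "Abs_fps f = 1 + C_series a"
    by (rule fps_ext) (simp add: C_series_def f_def)
  then show ?thesis
    using rooted_fps_compose[where f = f, OF f0] unfolding D by (simp add: fps_compose_add_distrib)
qed

text \<open>For the second identity let \<open>W = fps_X / (1 + C_series a)\<close> and substitute
  \<open>F\<close> into \<open>W * (1 + C_series a) = fps_X\<close>. The first identity turns
  \<open>1 + C_series a\<close> composed with \<open>F\<close> into \<open>D_series a\<close>, which
  then cancels.\<close>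

theorem lemma2p12:
  fixes a :: "nat set set \<Rightarrow> complex"
  shows "D_series a = 1 + fps_compose (C_series a) (fps_X * D_series a)
    \<and> fps_inv (fps_X * D_series a) = fps_X / (1 + C_series a)"
proof
  show D: "D_series a = 1 + fps_compose (C_series a) (fps_X * D_series a)"
    by (rule D_series_eq_compose)
  define F where "F = fps_X * D_series a"
  define C' where "C' = 1 + C_series a"
  have D0: "D_series a $ 0 = 1" by (simp add: D_series_def)
  have F0: "F $ 0 = 0" "F $ 1 \<noteq> 0" using D0 by (simp_all add: F_def)
  \<comment> \<open>The constant term of \<open>C'\<close> is 1, so \<open>C'\<close> is a unit and
    the quotient below is a genuine inverse multiple.\<close>
  have C0: "C' $ 0 \<noteq> 0" by (simp add: C'_def C_series_def)
  have DC: "C' oo F = D_series a"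
    using D by (simp add: F_def C'_def fps_compose_add_distrib)
  define W where "W = fps_X / C'"
  have "W * C' = fps_X" using C0 by (simp add: W_def fps_divide_unit inverse_mult_eq_1)
  then have "(W oo F) * (C' oo F) = F"
    using F0 by (metis fps_X_fps_compose_startby0 fps_compose_mult_distrib)
  then have "(W oo F) * D_series a = fps_X * D_series a"
    unfolding DC by (simp only: F_def)
  moreover have "D_series a \<noteq> 0" using D0 by auto
  ultimately have "W oo F = fps_X" by simp
  \<comment> \<open>\<open>W\<close> and \<open>fps_inv F\<close> are both left inverses of
    \<open>F\<close>, and composition with \<open>F\<close> on the right is injective.\<close>
  then have "W oo F = fps_inv F oo F" using fps_inv[OF F0] by simp
  then have "fps_inv F = W" using fps_compose_inj_right[OF F0] by metis
  then show "fps_inv (fps_X * D_series a) = fps_X / (1 + C_series a)"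
    by (simp add: F_def W_def C'_def)
qed

end
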